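(* Let $n\in\mathbb{N}$ and let $\mathcal{U}(n)$ be the $n$-universal model of intuitionistic propositional logic $\mathsf{IPC}$. For every formula $\phi$ of the team language whose propositional variables are among $p_1,\dots,p_n$, $$\mathcal{U}(n)\models_{\mathsf{t}}\phi\iff\ \vdash_{\mathsf{tIPC}}\phi .$$
   Context: **Language.** Fix a set $\mathsf{Prop}$ of propositional variables. Formulas of the team language are $\phi::=p\mid\bot\mid\phi\wedge\phi\mid\phi\vee\phi\mid\phi\veebar\phi\mid\phi\to\phi$ with $p\in\mathsf{Prop}$; $\vee$ is the local disjunction and $\veebar$ the global disjunction. Formulas without $\veebar$ are called standard formulas. **Models.** An intuitionistic Kripke model is $\mathfrak{M}=(W,R,V)$ with $W\neq\varnothing$, $R$ a partial order on $W$, and $V:\mathsf{Prop}\to\wp(W)$ persistent ($w\in V(p)$ and $wRv$ imply $v\in V(p)$). An $n$-model is a model whose valuation is restricted to $p_1,\dots,p_n$. An immediate successor of $w$ is a proper successor $v$ of $w$ with no point strictly between $w$ and $v$; $\lceil w\rceil$ is the set of immediate successors of $w$. **Team semantics.** A team is a set $t\subseteq W$. For teams, $tR^\circ s$ iff $\forall w\in t\,\exists v\in s\,(wRv)$ and $\forall v\in s\,\exists w\in t\,(wRv)$. Write $t\supseteq\circ R^\circ s$ iff there is $r\subseteq W$ with $t\supseteq r$ and $rR^\circ s$. Satisfaction: - $\mathfrak{M},t\models p$ iff $t\subseteq V(p)$; - $\mathfrak{M},t\models\bot$ iff $t=\varnothing$; - $\mathfrak{M},t\models\phi\wedge\psi$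 iff $\mathfrak{M},t\models\phi$ and $\mathfrak{M},t\models\psi$; - $\mathfrak{M},t\models\phi\vee\psi$ iff there are $s,r\subseteq W$ with $t\subseteq s\cup r$, $\mathfrak{M},s\models\phi$ and $\mathfrak{M},r\models\psi$; - $\mathfrak{M},t\models\phi\veebar\psi$ iff $\mathfrak{M},t\models\phi$ or $\mathfrak{M},t\models\psi$; - $\mathfrak{M},t\models\phi\to\psi$ iff for all $s\subseteq W$ with $t\supseteq\circ R^\circ s$, $\mathfrak{M},s\models\phi$ implies $\mathfrak{M},s\models\psi$. $\mathfrak{M}\models_{\mathsf{t}}\phi$ means $\mathfrak{M},t\models\phi$ for all teams $t\subseteq W$. **The system $\mathsf{tIPC}$.** This is the Hilbert system with Modus Ponens as its rule and the following axioms, where $\phi,\psi,\chi$ are arbitrary formulas and $\alpha$ is an arbitrary standard formula: 1. $\phi\to\phi\vee\psi$; 2. $(\phi\to\alpha)\to((\psi\to\alpha)\to(\phi\vee\psi\to\alpha))$; 3. $(\phi\to\chi)\to(\phi\vee\psi\to\chi\vee\psi)$; 4. $\phi\vee\psi\to\psi\vee\phi$; 5. $(\phi\vee\psi)\vee\chi\to\phi\vee(\psi\vee\chi)$; 6. $\phi\vee(\psi\veebar\chi)\to(\phi\vee\psi)\veebar(\phi\vee\chi)$; 7. $\phi\to(\psi\to\phi)$; $(\phi\to(\psi\to\chi))\to((\phi\to\psi)\to(\phi\to\chi))$; $(\phi\wedge\psi)\to\phi$; $(\phi\wedge\psi)\to\psi$; $\phi\to(\psi\to(\phi\wedge\psi))$;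 $\phi\to(\phi\veebar\psi)$; $\psi\to(\phi\veebar\psi)$; $(\phi\to\chi)\to((\psi\to\chi)\to((\phi\veebar\psi)\to\chi))$; $\bot\to\phi$; 8. $(\alpha\to\phi\veebar\psi)\to(\alpha\to\phi)\veebar(\alpha\to\psi)$. $\vdash_{\mathsf{tIPC}}\phi$ means $\phi$ is derivable in this system. **Universal model.** The color of a point $w$ in an $n$-model is the sequence $col(w)=c_1\dots c_n\in\{0,1\}^n$ with $c_i=1$ iff $w\in V(p_i)$. Colors are ordered componentwise by $\leq$, with strict part $<$. The $n$-universal model $\mathcal{U}(n)=(W,R,V)$ is built inductively in layers; $R$ is the reflexive transitive closure of the immediate-successor relation specified. The first layer consists of $2^n$ nodes of pairwise distinct colors (one for each color), without proper successors. Given layers $\leq k$, layer $k+1$ consists of: (i) for every node $w$ in layer $k$ and every color $c<col(w)$, a new node $v$ with $col(v)=c$ and $\lceil v\rceil=\{w\}$; (ii) for every finite set $A$ of at least two pairwise $R$-incomparable nodes from layers $\leq k$, at least one of which is in layer $k$, and every color $c$ with $c\leq col(w)$ for all $w\in A$, a new node $v$ with $col(v)=c$ and $\lceil v\rceil=A$. *)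

theory Defs
  imports "HOL-Library.FSet"
begin

text \<open>\<open>Or\<close> is the local disjunction, \<open>GOr\<close> the global one.\<close>

datatype (props: 'p) form =
    Var 'p
  | Bot  (\<open>\<^bold>\<bottom>\<close>)
  | And "'p form" "'p form"  (infixr \<open>\<^bold>\<and>\<close> 75)
  | Or "'p form" "'p form"  (infixr \<open>\<^bold>\<or>\<close> 70)
  | GOr "'p form" "'p form"  (infixr \<open>\<^bold>\<or>\<^sup>g\<close> 65)
  | Imp "'p form" "'p form"  (infixr \<open>\<^bold>\<rightarrow>\<close> 60)

primrec standard :: "'p form \<Rightarrow> bool" where
  "standard (Var q) = True"
| "standard \<^bold>\<bottom> = True"
| "standard (\<phi> \<^bold>\<and> \<psi>) = (standard \<phi> \<and> standard \<psi>)"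
| "standard (\<phi> \<^bold>\<or> \<psi>) = (standard \<phi> \<and> standard \<psi>)"
| "standard (\<phi> \<^bold>\<or>\<^sup>g \<psi>) = False"
| "standard (\<phi> \<^bold>\<rightarrow> \<psi>) = (standard \<phi> \<and> standard \<psi>)"

record ('w, 'p) model =
  worlds :: "'w set"
  acc :: "('w \<times> 'w) set"
  val :: "'p \<Rightarrow> 'w set"

definition kripke_model :: "('w, 'p) model \<Rightarrow> bool" where
  "kripke_model M \<longleftrightarrow>
     worlds M \<noteq> {} \<and> partial_order_on (worlds M) (acc M) \<and>
     (\<forall>q. val M q \<subseteq> worlds M) \<and>
     (\<forall>q w v. w \<in> val M q \<longrightarrow> (w, v) \<in> acc M \<longrightarrow> v \<in> val M q)"

definition imm_succ :: "('w, 'p) model \<Rightarrow> 'w \<Rightarrow> 'w set" where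
  "imm_succ M w = {v. (w, v) \<in> acc M \<and> v \<noteq> w \<and>
     \<not> (\<exists>u. (w, u) \<in> acc M \<and> (u, v) \<in> acc M \<and> u \<noteq> w \<and> u \<noteq> v)}"

definition team_rel :: "('w, 'p) model \<Rightarrow> 'w set \<Rightarrow> 'w set \<Rightarrow> bool" where
  "team_rel M t s \<longleftrightarrow>
     (\<forall>w\<in>t. \<exists>v\<in>s. (w, v) \<in> acc M) \<and> (\<forall>v\<in>s. \<exists>w\<in>t. (w, v) \<in> acc M)"

definition sub_team_rel :: "('w, 'p) model \<Rightarrow> 'w set \<Rightarrow> 'w set \<Rightarrow> bool" where
  "sub_team_rel M t s \<longleftrightarrow> (\<exists>r \<subseteq> worlds M. r \<subseteq> t \<and> team_rel M r s)"

primrec sat :: "('w, 'p) model \<Rightarrow> 'w set \<Rightarrow> 'p form \<Rightarrow> bool"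
  (\<open>_, _ \<Turnstile> _\<close> [55, 55, 55] 50)
  where
  "(M, t \<Turnstile> Var q) \<longleftrightarrow> t \<subseteq> val M q"
| "(M, t \<Turnstile> \<^bold>\<bottom>) \<longleftrightarrow> t = {}"
| "(M, t \<Turnstile> \<phi> \<^bold>\<and> \<psi>) \<longleftrightarrow> (M, t \<Turnstile> \<phi>) \<and> (M, t \<Turnstile> \<psi>)"
| "(M, t \<Turnstile> \<phi> \<^bold>\<or> \<psi>) \<longleftrightarrow>
     (\<exists>s \<subseteq> worlds M. \<exists>r \<subseteq> worlds M. t \<subseteq> s \<union> r \<and> (M, s \<Turnstile> \<phi>) \<and> (M, r \<Turnstile> \<psi>))"
| "(M, t \<Turnstile> \<phi> \<^bold>\<or>\<^sup>g \<psi>) \<longleftrightarrow> (M, t \<Turnstile> \<phi>) \<or> (M, t \<Turnstile> \<psi>)"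
| "(M, t \<Turnstile> \<phi> \<^bold>\<rightarrow> \<psi>) \<longleftrightarrow>
     (\<forall>s \<subseteq> worlds M. sub_team_rel M t s \<longrightarrow> (M, s \<Turnstile> \<phi>) \<longrightarrow> (M, s \<Turnstile> \<psi>))"

definition team_valid :: "('w, 'p) model \<Rightarrow> 'p form \<Rightarrow> bool"  (\<open>_ \<Turnstile>\<^sub>t _\<close> [55, 55] 50) where
  "(M \<Turnstile>\<^sub>t \<phi>) \<longleftrightarrow> (\<forall>t \<subseteq> worlds M. M, t \<Turnstile> \<phi>)"

inductive tIPC :: "'p form \<Rightarrow> bool"  (\<open>\<turnstile>\<^sub>t\<^sub>I\<^sub>P\<^sub>C _\<close> [55] 50) where
  Or_intro: "\<turnstile>\<^sub>t\<^sub>I\<^sub>P\<^sub>C \<phi> \<^bold>\<rightarrow> (\<phi> \<^bold>\<or> \<psi>)"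
| Or_elim: "standard \<alpha> \<Longrightarrow>
    \<turnstile>\<^sub>t\<^sub>I\<^sub>P\<^sub>C (\<phi> \<^bold>\<rightarrow> \<alpha>) \<^bold>\<rightarrow> ((\<psi> \<^bold>\<rightarrow> \<alpha>) \<^bold>\<rightarrow> ((\<phi> \<^bold>\<or> \<psi>) \<^bold>\<rightarrow> \<alpha>))"
| Or_mono: "\<turnstile>\<^sub>t\<^sub>I\<^sub>P\<^sub>C (\<phi> \<^bold>\<rightarrow> \<chi>) \<^bold>\<rightarrow> ((\<phi> \<^bold>\<or> \<psi>) \<^bold>\<rightarrow> (\<chi> \<^bold>\<or> \<psi>))"
| Or_comm: "\<turnstile>\<^sub>t\<^sub>I\<^sub>P\<^sub>C (\<phi> \<^bold>\<or> \<psi>) \<^bold>\<rightarrow> (\<psi> \<^bold>\<or> \<phi>)"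
| Or_assoc: "\<turnstile>\<^sub>t\<^sub>I\<^sub>P\<^sub>C ((\<phi> \<^bold>\<or> \<psi>) \<^bold>\<or> \<chi>) \<^bold>\<rightarrow> (\<phi> \<^bold>\<or> (\<psi> \<^bold>\<or> \<chi>))"
| Or_GOr_distrib: "\<turnstile>\<^sub>t\<^sub>I\<^sub>P\<^sub>C (\<phi> \<^bold>\<or> (\<psi> \<^bold>\<or>\<^sup>g \<chi>)) \<^bold>\<rightarrow> ((\<phi> \<^bold>\<or> \<psi>) \<^bold>\<or>\<^sup>g (\<phi> \<^bold>\<or> \<chi>))"
| K: "\<turnstile>\<^sub>t\<^sub>I\<^sub>P\<^sub>C \<phi> \<^bold>\<rightarrow> (\<psi> \<^bold>\<rightarrow> \<phi>)"
| S: "\<turnstile>\<^sub>t\<^sub>I\<^sub>P\<^sub>C (\<phi> \<^bold>\<rightarrow> (\<psi> \<^bold>\<rightarrow> \<chi>)) \<^bold>\<rightarrow> ((\<phi> \<^bold>\<rightarrow> \<psi>) \<^bold>\<rightarrow> (\<phi> \<^bold>\<rightarrow> \<chi>))"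
| And_elim1: "\<turnstile>\<^sub>t\<^sub>I\<^sub>P\<^sub>C (\<phi> \<^bold>\<and> \<psi>) \<^bold>\<rightarrow> \<phi>"
| And_elim2: "\<turnstile>\<^sub>t\<^sub>I\<^sub>P\<^sub>C (\<phi> \<^bold>\<and> \<psi>) \<^bold>\<rightarrow> \<psi>"
| And_intro: "\<turnstile>\<^sub>t\<^sub>I\<^sub>P\<^sub>C \<phi> \<^bold>\<rightarrow> (\<psi> \<^bold>\<rightarrow> (\<phi> \<^bold>\<and> \<psi>))"
| GOr_intro1: "\<turnstile>\<^sub>t\<^sub>I\<^sub>P\<^sub>C \<phi> \<^bold>\<rightarrow> (\<phi> \<^bold>\<or>\<^sup>g \<psi>)"
| GOr_intro2: "\<turnstile>\<^sub>t\<^sub>I\<^sub>P\<^sub>C \<psi> \<^bold>\<rightarrow> (\<phi> \<^bold>\<or>\<^sup>g \<psi>)"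
| GOr_elim: "\<turnstile>\<^sub>t\<^sub>I\<^sub>P\<^sub>C (\<phi> \<^bold>\<rightarrow> \<chi>) \<^bold>\<rightarrow> ((\<psi> \<^bold>\<rightarrow> \<chi>) \<^bold>\<rightarrow> ((\<phi> \<^bold>\<or>\<^sup>g \<psi>) \<^bold>\<rightarrow> \<chi>))"
| Ex_falso: "\<turnstile>\<^sub>t\<^sub>I\<^sub>P\<^sub>C \<^bold>\<bottom> \<^bold>\<rightarrow> \<phi>"
| Split: "standard \<alpha> \<Longrightarrow>
    \<turnstile>\<^sub>t\<^sub>I\<^sub>P\<^sub>C (\<alpha> \<^bold>\<rightarrow> (\<phi> \<^bold>\<or>\<^sup>g \<psi>)) \<^bold>\<rightarrow> ((\<alpha> \<^bold>\<rightarrow> \<phi>) \<^bold>\<or>\<^sup>g (\<alpha> \<^bold>\<rightarrow> \<psi>))"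
| MP: "\<turnstile>\<^sub>t\<^sub>I\<^sub>P\<^sub>C \<phi> \<Longrightarrow> \<turnstile>\<^sub>t\<^sub>I\<^sub>P\<^sub>C \<phi> \<^bold>\<rightarrow> \<psi> \<Longrightarrow> \<turnstile>\<^sub>t\<^sub>I\<^sub>P\<^sub>C \<psi>"

text \<open>
  The variables \<open>p\<^sub>1, \<dots>, p\<^sub>n\<close> are numbered from 0, as \<open>p 0, \<dots>, p (n - 1)\<close>.  A color is a
  list of \<open>n\<close> truth values.
\<close>

definition color :: "nat \<Rightarrow> (nat \<Rightarrow> 'p) \<Rightarrow> ('w, 'p) model \<Rightarrow> 'w \<Rightarrow> bool list" where
  "color n p M w = map (\<lambda>i. w \<in> val M (p i)) [0..<n]"

definition color_le :: "bool list \<Rightarrow> bool list \<Rightarrow> bool" where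
  "color_le = list_all2 (\<le>)"

definition color_less :: "bool list \<Rightarrow> bool list \<Rightarrow> bool" where
  "color_less c d \<longleftrightarrow> color_le c d \<and> c \<noteq> d"

text \<open>
  A node of the universal model is determined by its color and its finite set of immediate
  successors, so it is represented as the pair of the two.
\<close>

datatype node = Node (label: "bool list") (succs: "node fset")

definition succ_rel :: "(node \<times> node) set" where
  "succ_rel = {(v, w). w |\<in>| succs v}"

text \<open>\<open>layer n k v\<close>: \<open>v\<close> belongs to layer \<open>k\<close>, where the first layer has index 1.\<close>

inductive layer :: "nat \<Rightarrow> nat \<Rightarrow> node \<Rightarrow> bool" for n where
  first: "length c = n \<Longrightarrow> layer n 1 (Node c {||})"
| single: "layer n k w \<Longrightarrow> color_less c (label w) \<Longrightarrow> layer n (Suc k) (Node c {|w|})"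
| multi: "2 \<le> fcard A \<Longrightarrow>
    (\<forall>w. w |\<in>| A \<longrightarrow> (\<exists>j\<le>k. layer n j w)) \<Longrightarrow>
    (\<exists>w. w |\<in>| A \<and> layer n k w) \<Longrightarrow>
    (\<forall>v w. v |\<in>| A \<longrightarrow> w |\<in>| A \<longrightarrow> v \<noteq> w \<longrightarrow> (v, w) \<notin> succ_rel\<^sup>*) \<Longrightarrow>
    (\<forall>w. w |\<in>| A \<longrightarrow> color_le c (label w)) \<Longrightarrow>
    layer n (Suc k) (Node c A)"

definition universal_worlds :: "nat \<Rightarrow> node set" where
  "universal_worlds n = {w. \<exists>k. layer n k w}"

definition universal_model :: "nat \<Rightarrow> (nat \<Rightarrow> 'p) \<Rightarrow> (node, 'p) model" where
  "universal_model n p = \<lparr>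
     worlds = universal_worlds n,
     acc = {(v, w). v \<in> universal_worlds n \<and> w \<in> universal_worlds n \<and> (v, w) \<in> succ_rel\<^sup>*},
     val = (\<lambda>q. {w \<in> universal_worlds n. \<exists>i<n. q = p i \<and> label w ! i})\<rparr>"

text \<open>
  Sanity checks: \<open>universal_model n p\<close> is a Kripke model in which the color and the immediate
  successors of a node, as defined for arbitrary models, are those recorded in it.
\<close>

lemma length_label: "layer n k w \<Longrightarrow> length (label w) = n"
proof (induction rule: layer.induct)
  case (multi A k c)
  then show ?case by (metis color_le_def list_all2_lengthD node.sel(1))
qed (auto simp: color_less_def color_le_def dest: list_all2_lengthD)

lemma universal_worlds_succ:
  assumes "v \<in> universal_worlds n" "w |\<in>| succs v"
  shows "w \<in> universal_worlds n" "color_le (label v) (label w)"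
proof -
  obtain k where "layer n k v"
    using assms by (auto simp: universal_worlds_def)
  then have "(\<exists>j. layer n j w) \<and> color_le (label v) (label w)"
    using assms(2) by cases (auto simp: color_less_def)
  then show "w \<in> universal_worlds n" "color_le (label v) (label w)"
    by (auto simp: universal_worlds_def)
qed

lemma universal_worlds_closed:
  "(v, w) \<in> succ_rel\<^sup>* \<Longrightarrow> v \<in> universal_worlds n \<Longrightarrow>
     w \<in> universal_worlds n \<and> color_le (label v) (label w)"
proof (induction rule: rtrancl_induct)
  case base
  then show ?case by (simp add: color_le_def list_all2_conv_all_nth)
next
  case (step u w)
  then have "u \<in> universal_worlds n" "color_le (label v) (label u)" "w |\<in>| succs u"
    by (simp_all add: succ_rel_def)
  with universal_worlds_succ[of u n w] show ?case
    by (auto simp: color_le_def list_all2_conv_all_nth)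
qed

lemma wf_succ_rel: "wf (succ_rel\<inverse>)"
proof (rule wfUNIVI)
  fix P x
  assume "\<forall>x. (\<forall>y. (y, x) \<in> succ_rel\<inverse> \<longrightarrow> P y) \<longrightarrow> P x"
  then show "P x"
    by (induction x) (auto simp: succ_rel_def)
qed

lemma antisym_succ_rel: "antisym (succ_rel\<^sup>*)"
  by (metis acyclic_converse acyclic_impl_antisym_rtrancl wf_acyclic wf_succ_rel)

lemma kripke_model_universal_model: "kripke_model (universal_model n p)"
proof -
  have "Node (replicate n True) {||} \<in> universal_worlds n"
    using layer.first[of "replicate n True" n] by (auto simp: universal_worlds_def)
  moreover have "label w ! i"
    if "(v, w) \<in> succ_rel\<^sup>*" "v \<in> universal_worlds n" "i < n" "label v ! i" for v w i
    using universal_worlds_closed[OF that(1,2)] that(2-4)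
    by (auto simp: color_le_def list_all2_conv_all_nth universal_worlds_def length_label)
  ultimately show ?thesis
    using antisym_succ_rel
    by (auto simp: kripke_model_def universal_model_def partial_order_on_def preorder_on_def
        refl_on_def trans_def antisym_def)
qed

lemma color_universal_model:
  assumes "inj_on p {..<n}" "w \<in> worlds (universal_model n p)"
  shows "color n p (universal_model n p) w = label w"
proof (rule nth_equalityI)
  show len: "length (color n p (universal_model n p) w) = length (label w)"
    using assms(2)
    by (auto simp: color_def universal_model_def universal_worlds_def length_label)
  fix i assume "i < length (color n p (universal_model n p) w)"
  then have i: "i < n" by (simp add: color_def)
  have "(\<exists>j<n. p i = p j \<and> label w ! j) \<longleftrightarrow> label w ! i"
    using assms(1) i by (metis inj_onD lessThan_iff)
  then show "color n p (universal_model n p) w ! i = label w ! i"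
    using assms(2) i by (simp add: color_def universal_model_def)
qed

lemma imm_succ_universal_model:
  assumes "v \<in> worlds (universal_model n p)"
  shows "imm_succ (universal_model n p) v = fset (succs v)"
proof -
  have v: "v \<in> universal_worlds n"
    using assms by (simp add: universal_model_def)
  have acc: "(x, y) \<in> acc (universal_model n p) \<longleftrightarrow>
      x \<in> universal_worlds n \<and> (x, y) \<in> succ_rel\<^sup>*" for x y
    using universal_worlds_closed by (auto simp: universal_model_def)
  have irr: "x \<noteq> y" if "y |\<in>| succs x" for x y
    using that wf_not_refl[OF wf_succ_rel, of x] by (auto simp: succ_rel_def)
  have inc: "(x, y) \<notin> succ_rel\<^sup>*" if "x |\<in>| succs v" "y |\<in>| succs v" "x \<noteq> y" for x y
  proof -
    obtain k where "layer n k v"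
      using v by (auto simp: universal_worlds_def)
    then show ?thesis
      using that by cases auto
  qed
  have step: "\<exists>x. x |\<in>| succs v \<and> (x, u) \<in> succ_rel\<^sup>*" if "(v, u) \<in> succ_rel\<^sup>*" "u \<noteq> v" for u
    using that(1) by (cases rule: converse_rtranclE) (use that(2) in \<open>auto simp: succ_rel_def\<close>)
  have r: "(v, x) \<in> succ_rel\<^sup>*" if "x |\<in>| succs v" for x
    using that by (auto simp: succ_rel_def)
  show ?thesis
  proof (intro equalityI subsetI)
    fix w assume w: "w \<in> imm_succ (universal_model n p) v"
    then obtain x where x: "x |\<in>| succs v" "(x, w) \<in> succ_rel\<^sup>*"
      using step[of w] by (auto simp: imm_succ_def acc)
    then have "x = w"
      using w irr[OF x(1)] v r[OF x(1)] universal_worlds_succ(1)[OF v x(1)]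
      by (auto simp: imm_succ_def acc)
    then show "w \<in> fset (succs v)" using x by simp
  next
    fix w assume w: "w \<in> fset (succs v)"
    have False if u: "(v, u) \<in> succ_rel\<^sup>*" "(u, w) \<in> succ_rel\<^sup>*" "u \<noteq> v" "u \<noteq> w" for u
    proof -
      obtain x where x: "x |\<in>| succs v" "(x, u) \<in> succ_rel\<^sup>*"
        using step u by blast
      then have "x = w"
        using inc[of x w] w u(2) by (meson rtrancl_trans)
      then show False
        using x u antisym_succ_rel by (auto dest: antisymD)
    qed
    then show "w \<in> imm_succ (universal_model n p) v"
      using w irr r v by (auto simp: imm_succ_def acc)
  qed
qed

end

theory Submission
  imports Defs
begin

text \<open>
  Soundness rests on two facts: satisfaction is inherited by teams lying above the given one, and
  standard formulas are flat, i.e. a team satisfies them iff each of its points forces them.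
  For completeness, axioms 6 and 8 bring every formula into a global disjunction of
  standard ones.  If \<open>\<U>(n)\<close> validates such a disjunction, the team of all worlds satisfies one of
  its disjuncts, which by flatness is forced everywhere in \<open>\<U>(n)\<close>.  An underivable standard formula,
  however, is refuted in the finite canonical model over its subformulas, and every finite model
  maps into \<open>\<U>(n)\<close> by a color-preserving bounded morphism.
\<close>

section \<open>Soundness\<close>

text \<open>Two restrictions shape the completeness argument. Elimination of local disjunction is
  available for standard conclusions only, so the usual extension to a prime theory works only when
  the formula to be avoided is standard; hence the reduction to standard disjuncts. Canonical
  theories are then built with derivability in tIPC itself, whose derivations may pass through
  global disjunctions even when the end formula is standard. Working inside the finite set of
  subformulas makes the countermodel finite. The morphism need not be injective: no node has exactly
  one immediate successor and the color of that successor, so a point may have to share its image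
  with a point above it.

  The entry above contains a stray symbol, so here is the complete list again.\<close>

lemma kripke_model_acc:
  assumes "kripke_model M"
  shows "w \<in> worlds M \<Longrightarrow> (w, w) \<in> acc M"
    and "(w, v) \<in> acc M \<Longrightarrow> (v, u) \<in> acc M \<Longrightarrow> (w, u) \<in> acc M"
    and "(w, v) \<in> acc M \<Longrightarrow> (v, w) \<in> acc M \<Longrightarrow> v = w"
    and "(w, v) \<in> acc M \<Longrightarrow> w \<in> worlds M \<and> v \<in> worlds M"
    and "w \<in> val M q \<Longrightarrow> (w, v) \<in> acc M \<Longrightarrow> v \<in> val M q"
  using assms
  by (auto simp: kripke_model_def partial_order_on_def preorder_on_def
      dest: refl_onD transD antisymD)

text \<open>The points of \<open>t\<close> that see some point of \<open>s\<close> always form a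
  suitable intermediate team. The relation behind implication is thus inclusion of \<open>s\<close>
  in the upward closure of \<open>t\<close>.\<close>

lemma sub_team_rel_iff:
  assumes "kripke_model M"
  shows "sub_team_rel M t s \<longleftrightarrow> (\<forall>v\<in>s. \<exists>w\<in>t. (w, v) \<in> acc M)" (is "_ \<longleftrightarrow> ?R")
proof
  assume ?R
  let ?r = "{w \<in> t. \<exists>v\<in>s. (w, v) \<in> acc M}"
  have "?r \<subseteq> worlds M" using kripke_model_acc(4)[OF assms] by blast
  moreover have "?r \<subseteq> t" "team_rel M ?r s"
    using \<open>?R\<close> unfolding team_rel_def by blast+
  ultimately show "sub_team_rel M t s" unfolding sub_team_rel_def by blast
next
  assume "sub_team_rel M t s"
  then show ?R unfolding sub_team_rel_def team_rel_def by blast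
qed

text \<open>Covers persistence and closure under subteams at once: each point of \<open>s\<close>
  needs a point of \<open>t\<close> below it, while points of \<open>t\<close> may be left without a
  successor in \<open>s\<close>.\<close>

lemma sat_persistent:
  assumes M: "kripke_model M"
  shows "M, t \<Turnstile> \<phi> \<Longrightarrow> \<forall>v\<in>s. \<exists>w\<in>t. (w, v) \<in> acc M \<Longrightarrow> M, s \<Turnstile> \<phi>"
proof (induction \<phi> arbitrary: t s)
  case (Var q)
  then show ?case using kripke_model_acc(5)[OF M] by fastforce
next
  case (Or \<phi> \<psi>)
  then obtain a b where ab: "a \<subseteq> worlds M" "b \<subseteq> worlds M" "t \<subseteq> a \<union> b" "M, a \<Turnstile> \<phi>" "M, b \<Turnstile> \<psi>"
    by auto
  \<comment> \<open>The two pieces of \<open>t\<close> are replaced by their upward closures, which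
    cover \<open>s\<close> and satisfy the disjuncts by the induction hypotheses.\<close>
  let ?up = "\<lambda>x. {v. \<exists>w\<in>x. (w, v) \<in> acc M}"
  have "M, ?up a \<Turnstile> \<phi>" "M, ?up b \<Turnstile> \<psi>"
    using Or.IH(1)[OF ab(4)] Or.IH(2)[OF ab(5)] by auto
  moreover have "?up a \<subseteq> worlds M" "?up b \<subseteq> worlds M" "s \<subseteq> ?up a \<union> ?up b"
    using kripke_model_acc(4)[OF M] Or.prems(2) ab(3) by blast+
  ultimately show ?case unfolding sat.simps by blast
next
  case (Imp \<phi> \<psi>)
  have "\<forall>v\<in>u. \<exists>w\<in>t. (w, v) \<in> acc M" if "\<forall>v\<in>u. \<exists>w\<in>s. (w, v) \<in> acc M" for u
    using that Imp.prems(2) kripke_model_acc(2)[OF M] by meson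
  then show ?case using Imp.prems(1) by (auto simp: sub_team_rel_iff[OF M])
next
  case (And \<phi> \<psi>)
  then show ?case unfolding sat.simps by blast
next
  case (GOr \<phi> \<psi>)
  then show ?case unfolding sat.simps by blast
qed auto

lemma sat_subset:
  assumes "kripke_model M" "M, t \<Turnstile> \<phi>" "s \<subseteq> t" "s \<subseteq> worlds M"
  shows "M, s \<Turnstile> \<phi>"
  using sat_persistent[OF assms(1,2), of s] assms(3,4) kripke_model_acc(1)[OF assms(1)] by blast

lemma sat_Imp_iff:
  assumes "kripke_model M"
  shows "(M, t \<Turnstile> \<phi> \<^bold>\<rightarrow> \<psi>) \<longleftrightarrow>
    (\<forall>s. (\<forall>v\<in>s. \<exists>w\<in>t. (w, v) \<in> acc M) \<longrightarrow> (M, s \<Turnstile> \<phi>) \<longrightarrow> (M, s \<Turnstile> \<psi>))"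
proof -
  have "s \<subseteq> worlds M" if "\<forall>v\<in>s. \<exists>w\<in>t. (w, v) \<in> acc M" for s
    using that kripke_model_acc(4)[OF assms] by blast
  then show ?thesis unfolding sat.simps sub_team_rel_iff[OF assms] by blast
qed

text \<open>The clause for \<open>\<^bold>\<or>\<^sup>g\<close> is a dummy: the relation is meant for standard formulas only.\<close>

primrec forces :: "('w, 'p) model \<Rightarrow> 'w \<Rightarrow> 'p form \<Rightarrow> bool" where
  "forces M w (Var q) \<longleftrightarrow> w \<in> val M q"
| "forces M w \<^bold>\<bottom> \<longleftrightarrow> False"
| "forces M w (\<phi> \<^bold>\<and> \<psi>) \<longleftrightarrow> forces M w \<phi> \<and> forces M w \<psi>"
| "forces M w (\<phi> \<^bold>\<or> \<psi>) \<longleftrightarrow> forces M w \<phi> \<or> forces M w \<psi>"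
| "forces M w (\<phi> \<^bold>\<or>\<^sup>g \<psi>) \<longleftrightarrow> forces M w \<phi> \<or> forces M w \<psi>"
| "forces M w (\<phi> \<^bold>\<rightarrow> \<psi>) \<longleftrightarrow> (\<forall>v. (w, v) \<in> acc M \<longrightarrow> forces M v \<phi> \<longrightarrow> forces M v \<psi>)"

text \<open>Global disjunction is the only connective whose clause makes one choice for the whole
  team. A local disjunction splits the team according to the disjunct that a point forces, and an
  implication can be tested on singleton teams.\<close>

lemma sat_standard_iff_forces:
  assumes M: "kripke_model M"
  shows "standard \<alpha> \<Longrightarrow> t \<subseteq> worlds M \<Longrightarrow> (M, t \<Turnstile> \<alpha>) \<longleftrightarrow> (\<forall>w\<in>t. forces M w \<alpha>)"
proof (induction \<alpha> arbitrary: t)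
  case (Or \<phi> \<psi>)
  show ?case
  proof
    assume "M, t \<Turnstile> \<phi> \<^bold>\<or> \<psi>"
    then obtain a b where ab: "a \<subseteq> worlds M" "b \<subseteq> worlds M" "t \<subseteq> a \<union> b" "M, a \<Turnstile> \<phi>" "M, b \<Turnstile> \<psi>"
      unfolding sat.simps by blast
    then have "\<forall>w\<in>a. forces M w \<phi>" "\<forall>w\<in>b. forces M w \<psi>"
      using Or.IH(1)[of a] Or.IH(2)[of b] Or.prems(1) by simp_all
    then show "\<forall>w\<in>t. forces M w (\<phi> \<^bold>\<or> \<psi>)" using ab(3) by auto
  next
    assume *: "\<forall>w\<in>t. forces M w (\<phi> \<^bold>\<or> \<psi>)"
    let ?a = "{w\<in>t. forces M w \<phi>}" and ?b = "{w\<in>t. forces M w \<psi>}"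
    have "?a \<subseteq> worlds M" "?b \<subseteq> worlds M" using Or.prems(2) by auto
    moreover from this have "M, ?a \<Turnstile> \<phi>" "M, ?b \<Turnstile> \<psi>"
      using Or.IH(1)[of ?a] Or.IH(2)[of ?b] Or.prems(1) by simp_all
    moreover have "t \<subseteq> ?a \<union> ?b" using * by auto
    ultimately show "M, t \<Turnstile> \<phi> \<^bold>\<or> \<psi>" unfolding sat.simps by blast
  qed
next
  case (Imp \<phi> \<psi>)
  have IH: "(M, s \<Turnstile> \<phi>) \<longleftrightarrow> (\<forall>w\<in>s. forces M w \<phi>)" "(M, s \<Turnstile> \<psi>) \<longleftrightarrow> (\<forall>w\<in>s. forces M w \<psi>)"
    if "\<forall>v\<in>s. \<exists>w\<in>t. (w, v) \<in> acc M" for s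
  proof -
    have "s \<subseteq> worlds M" using that kripke_model_acc(4)[OF M] by blast
    then show "(M, s \<Turnstile> \<phi>) \<longleftrightarrow> (\<forall>w\<in>s. forces M w \<phi>)" "(M, s \<Turnstile> \<psi>) \<longleftrightarrow> (\<forall>w\<in>s. forces M w \<psi>)"
      using Imp.IH(1)[of s] Imp.IH(2)[of s] Imp.prems(1) by simp_all
  qed
  show ?case
  proof
    assume L: "M, t \<Turnstile> \<phi> \<^bold>\<rightarrow> \<psi>"
    have "forces M v \<psi>" if "w \<in> t" "(w, v) \<in> acc M" "forces M v \<phi>" for w v
      using L IH[of "{v}"] that unfolding sat_Imp_iff[OF M] by blast
    then show "\<forall>w\<in>t. forces M w (\<phi> \<^bold>\<rightarrow> \<psi>)" by auto
  next
    assume R: "\<forall>w\<in>t. forces M w (\<phi> \<^bold>\<rightarrow> \<psi>)"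
    have "M, s \<Turnstile> \<psi>" if s: "\<forall>v\<in>s. \<exists>w\<in>t. (w, v) \<in> acc M" and "M, s \<Turnstile> \<phi>" for s
    proof -
      have "\<forall>v\<in>s. forces M v \<phi>" using IH(1)[OF s] that(2) by simp
      then have "\<forall>v\<in>s. forces M v \<psi>" using R s unfolding forces.simps by blast
      then show ?thesis using IH(2)[OF s] by simp
    qed
    then show "M, t \<Turnstile> \<phi> \<^bold>\<rightarrow> \<psi>" unfolding sat_Imp_iff[OF M] by blast
  qed
next
  case (And \<phi> \<psi>)
  then show ?case by (simp add: ball_conj_distrib)
next
  case (Var q)
  show ?case by (simp add: subset_eq)
qed simp_all

text \<open>The semantic clause allows a cover larger than the team; closure under subteams trims it
  to an exact decomposition, whose parts lie above whatever the team lies above.\<close>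

lemma sat_Or_elim:
  assumes M: "kripke_model M" and "M, t \<Turnstile> \<phi> \<^bold>\<or> \<psi>" "t \<subseteq> worlds M"
  obtains a b where "t = a \<union> b" "M, a \<Turnstile> \<phi>" "M, b \<Turnstile> \<psi>"
proof -
  obtain a b where ab: "t \<subseteq> a \<union> b" "M, a \<Turnstile> \<phi>" "M, b \<Turnstile> \<psi>"
    using assms(2) by auto
  have "t = (a \<inter> t) \<union> (b \<inter> t)" "M, a \<inter> t \<Turnstile> \<phi>" "M, b \<inter> t \<Turnstile> \<psi>"
    using ab sat_subset[OF M ab(2), of "a \<inter> t"] sat_subset[OF M ab(3), of "b \<inter> t"] assms(3)
    by auto
  then show thesis by (rule that)
qed

lemma sat_Or_intro:
  "a \<union> b \<subseteq> worlds M \<Longrightarrow> M, a \<Turnstile> \<phi> \<Longrightarrow> M, b \<Turnstile> \<psi> \<Longrightarrow> M, a \<union> b \<Turnstile> \<phi> \<^bold>\<or> \<psi>"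
  unfolding sat.simps by (metis Un_subset_iff order_refl)

text \<open>Supplies the idle part of the split in axiom 1, and ex falso, where the team is
  empty.\<close>

lemma sat_empty:
  assumes "kripke_model M"
  shows "M, {} \<Turnstile> \<phi>"
proof (induction \<phi>)
  case (Imp \<phi> \<psi>)
  then show ?case by (auto simp: sub_team_rel_iff[OF assms])
qed auto

lemma team_soundness:
  assumes M: "kripke_model M"
    and "\<turnstile>\<^sub>t\<^sub>I\<^sub>P\<^sub>C \<phi>"
  shows "M \<Turnstile>\<^sub>t \<phi>"
proof -
  \<comment> \<open>With \<open>up\<close>, nested implications become chains of inclusions
    \<open>s \<subseteq> up t\<close>, composed by \<open>up_trans\<close>.\<close>
  define up where "up t = {v. \<exists>w\<in>t. (w, v) \<in> acc M}" for t
  have up_worlds: "up t \<subseteq> worlds M" for t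
    using kripke_model_acc(4)[OF M] by (auto simp: up_def)
  have up_refl: "t \<subseteq> worlds M \<Longrightarrow> t \<subseteq> up t" for t
    using kripke_model_acc(1)[OF M] by (auto simp: up_def)
  have up_trans: "s \<subseteq> up t \<Longrightarrow> r \<subseteq> up s \<Longrightarrow> r \<subseteq> up t" for t s r
    using kripke_model_acc(2)[OF M] by (force simp: up_def)
  have sat_up: "M, t \<Turnstile> \<phi> \<Longrightarrow> s \<subseteq> up t \<Longrightarrow> M, s \<Turnstile> \<phi>" for t s \<phi>
    by (rule sat_persistent[OF M]) (auto simp: up_def)
  have sat_ImpI: "M, t \<Turnstile> \<phi> \<^bold>\<rightarrow> \<psi>" if "\<And>s. s \<subseteq> up t \<Longrightarrow> M, s \<Turnstile> \<phi> \<Longrightarrow> M, s \<Turnstile> \<psi>" for t \<phi> \<psi>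
    using that unfolding sat_Imp_iff[OF M] up_def by blast
  have sat_ImpD: "M, s \<Turnstile> \<psi>" if "M, t \<Turnstile> \<phi> \<^bold>\<rightarrow> \<psi>" "s \<subseteq> up t" "M, s \<Turnstile> \<phi>" for t s \<phi> \<psi>
    using that unfolding sat_Imp_iff[OF M] up_def by blast
  \<comment> \<open>Since \<open>up t\<close> consists of worlds, the outermost implication of an
    axiom only asks that satisfaction pass from antecedent to consequent on each team.\<close>
  have valid_ImpI: "M \<Turnstile>\<^sub>t \<phi> \<^bold>\<rightarrow> \<psi>"
    if "\<And>t. t \<subseteq> worlds M \<Longrightarrow> M, t \<Turnstile> \<phi> \<Longrightarrow> M, t \<Turnstile> \<psi>" for \<phi> \<psi>
    unfolding team_valid_def using that up_worlds by (meson sat_ImpI subset_trans)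
  show ?thesis
    using assms(2)
  proof (induction rule: tIPC.induct)
    case (MP \<phi> \<psi>)
    have "M, t \<Turnstile> \<psi>" if t: "t \<subseteq> worlds M" for t
    proof -
      have "M, t \<Turnstile> \<phi> \<^bold>\<rightarrow> \<psi>" "M, t \<Turnstile> \<phi>" using MP t by (auto simp: team_valid_def)
      then show ?thesis
        using t kripke_model_acc(1)[OF M] unfolding sat_Imp_iff[OF M] by blast
    qed
    then show ?case by (simp add: team_valid_def)
  next
    case (Or_intro \<phi> \<psi>)
    show ?case
    proof (rule valid_ImpI)
      fix t assume "t \<subseteq> worlds M" "M, t \<Turnstile> \<phi>"
      then show "M, t \<Turnstile> \<phi> \<^bold>\<or> \<psi>"
        using sat_Or_intro[of t "{}" M \<phi> \<psi>] sat_empty[OF M] by simp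
    qed
  next
    case (Or_elim \<alpha> \<phi> \<psi>)
    show ?case
    proof (intro valid_ImpI sat_ImpI; assumption?)
      fix t s r
      assume A: "t \<subseteq> worlds M" "M, t \<Turnstile> \<phi> \<^bold>\<rightarrow> \<alpha>" "s \<subseteq> up t" "M, s \<Turnstile> \<psi> \<^bold>\<rightarrow> \<alpha>" "r \<subseteq> up s"
        "M, r \<Turnstile> \<phi> \<^bold>\<or> \<psi>"
      have r: "r \<subseteq> worlds M" using A(5) up_worlds by blast
      obtain a b where ab: "r = a \<union> b" "M, a \<Turnstile> \<phi>" "M, b \<Turnstile> \<psi>"
        using sat_Or_elim[OF M A(6) r] .
      have "a \<subseteq> up t" "b \<subseteq> up s" using ab(1) A(3,5) up_trans by blast+
      then have "M, a \<Turnstile> \<alpha>" "M, b \<Turnstile> \<alpha>" using A(2,4) ab sat_ImpD by blast+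
      \<comment> \<open>Flatness carries satisfaction from two parts to their union. A global
        disjunction could be decided differently on the parts, hence the restriction to standard
        conclusions.\<close>
      then show "M, r \<Turnstile> \<alpha>" using ab(1) r Or_elim sat_standard_iff_forces[OF M] by auto
    qed
  next
    case (Or_mono \<phi> \<chi> \<psi>)
    show ?case
    proof (intro valid_ImpI sat_ImpI; assumption?)
      fix t s
      assume A: "t \<subseteq> worlds M" "M, t \<Turnstile> \<phi> \<^bold>\<rightarrow> \<chi>" "s \<subseteq> up t" "M, s \<Turnstile> \<phi> \<^bold>\<or> \<psi>"
      have s: "s \<subseteq> worlds M" using A(3) up_worlds by blast
      obtain a b where ab: "s = a \<union> b" "M, a \<Turnstile> \<phi>" "M, b \<Turnstile> \<psi>"
        using sat_Or_elim[OF M A(4) s] .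
      then have "M, a \<Turnstile> \<chi>" using A(2,3) sat_ImpD by blast
      then show "M, s \<Turnstile> \<chi> \<^bold>\<or> \<psi>" using ab s sat_Or_intro by blast
    qed
  next
    case (Or_comm \<phi> \<psi>)
    show ?case by (rule valid_ImpI) (metis sat_Or_elim[OF M] sat_Or_intro Un_commute)
  next
    case (Or_assoc \<phi> \<psi> \<chi>)
    show ?case
    proof (rule valid_ImpI)
      fix t assume t: "t \<subseteq> worlds M" "M, t \<Turnstile> (\<phi> \<^bold>\<or> \<psi>) \<^bold>\<or> \<chi>"
      obtain s c where s: "t = s \<union> c" "M, s \<Turnstile> \<phi> \<^bold>\<or> \<psi>" "M, c \<Turnstile> \<chi>"
        using sat_Or_elim[OF M t(2,1)] .
      obtain a b where "s = a \<union> b" "M, a \<Turnstile> \<phi>" "M, b \<Turnstile> \<psi>"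
        using sat_Or_elim[OF M s(2)] s(1) t(1) by blast
      then show "M, t \<Turnstile> \<phi> \<^bold>\<or> (\<psi> \<^bold>\<or> \<chi>)"
        using s t(1) sat_Or_intro[of b c M \<psi> \<chi>] sat_Or_intro[of a "b \<union> c" M \<phi> "\<psi> \<^bold>\<or> \<chi>"]
        by (simp add: Un_assoc)
    qed
  next
    case (Or_GOr_distrib \<phi> \<psi> \<chi>)
    show ?case
    proof (rule valid_ImpI)
      fix t assume t: "t \<subseteq> worlds M" "M, t \<Turnstile> \<phi> \<^bold>\<or> (\<psi> \<^bold>\<or>\<^sup>g \<chi>)"
      obtain a b where ab: "t = a \<union> b" "M, a \<Turnstile> \<phi>" "M, b \<Turnstile> \<psi> \<^bold>\<or>\<^sup>g \<chi>"
        using sat_Or_elim[OF M t(2,1)] .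
      then show "M, t \<Turnstile> (\<phi> \<^bold>\<or> \<psi>) \<^bold>\<or>\<^sup>g (\<phi> \<^bold>\<or> \<chi>)"
        using t(1) sat_Or_intro[of a b M \<phi>] unfolding sat.simps(5) by blast
    qed
  next
    case (K \<phi> \<psi>)
    show ?case by (intro valid_ImpI sat_ImpI) (erule (1) sat_up)
  next
    case (S \<phi> \<psi> \<chi>)
    show ?case
    proof (intro valid_ImpI sat_ImpI; assumption?)
      fix t s r
      assume A: "t \<subseteq> worlds M" "M, t \<Turnstile> \<phi> \<^bold>\<rightarrow> \<psi> \<^bold>\<rightarrow> \<chi>" "s \<subseteq> up t" "M, s \<Turnstile> \<phi> \<^bold>\<rightarrow> \<psi>" "r \<subseteq> up s" "M, r \<Turnstile> \<phi>"
      have "M, r \<Turnstile> \<psi>"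
        by (rule sat_ImpD[OF A(4-6)])
      moreover have "M, r \<Turnstile> \<psi> \<^bold>\<rightarrow> \<chi>"
        by (rule sat_ImpD[OF A(2) up_trans[OF A(3,5)] A(6)])
      moreover have "r \<subseteq> up r" using A(5) up_refl up_worlds by blast
      ultimately show "M, r \<Turnstile> \<chi>" using sat_ImpD by blast
    qed
  next
    case (And_elim1 \<phi> \<psi>)
    show ?case by (rule valid_ImpI) simp
  next
    case (And_elim2 \<phi> \<psi>)
    show ?case by (rule valid_ImpI) simp
  next
    case (And_intro \<phi> \<psi>)
    show ?case by (intro valid_ImpI sat_ImpI) (simp, erule (1) sat_up)
  next
    case (GOr_intro1 \<phi> \<psi>)
    show ?case by (rule valid_ImpI) simp
  next
    case (GOr_intro2 \<psi> \<phi>)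
    show ?case by (rule valid_ImpI) simp
  next
    case (GOr_elim \<phi> \<chi> \<psi>)
    show ?case
    proof (intro valid_ImpI sat_ImpI; assumption?)
      fix t s r
      assume "t \<subseteq> worlds M" "M, t \<Turnstile> \<phi> \<^bold>\<rightarrow> \<chi>" "s \<subseteq> up t" "M, s \<Turnstile> \<psi> \<^bold>\<rightarrow> \<chi>" "r \<subseteq> up s"
        "M, r \<Turnstile> \<phi> \<^bold>\<or>\<^sup>g \<psi>"
      then show "M, r \<Turnstile> \<chi>" using sat_ImpD up_trans by (metis sat.simps(5))
    qed
  next
    case (Ex_falso \<phi>)
    show ?case by (rule valid_ImpI) (auto simp: sat_empty[OF M])
  next
    case (Split \<alpha> \<phi> \<psi>)
    show ?case
    proof (rule valid_ImpI)
      fix t assume t: "t \<subseteq> worlds M" "M, t \<Turnstile> \<alpha> \<^bold>\<rightarrow> (\<phi> \<^bold>\<or>\<^sup>g \<psi>)"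
      txt \<open>By flatness there is a largest team above \<open>t\<close> that satisfies \<open>\<alpha>\<close>.\<close>
      let ?u = "{v \<in> up t. forces M v \<alpha>}"
      have u: "?u \<subseteq> worlds M" using up_worlds by blast
      then have "M, ?u \<Turnstile> \<alpha>" using Split sat_standard_iff_forces[OF M] by auto
      then have "M, ?u \<Turnstile> \<phi> \<^bold>\<or>\<^sup>g \<psi>" using t(2) by (rule sat_ImpD[rotated -1]) auto
      moreover have "s \<subseteq> ?u" if "s \<subseteq> up t" "M, s \<Turnstile> \<alpha>" for s
        using that Split sat_standard_iff_forces[OF M, of \<alpha> s] up_worlds by blast
      then have "M, s \<Turnstile> \<chi>" if "M, ?u \<Turnstile> \<chi>" "s \<subseteq> up t" "M, s \<Turnstile> \<alpha>" for \<chi> s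
        using that sat_subset[OF M that(1), of s] u by blast
      ultimately show "M, t \<Turnstile> (\<alpha> \<^bold>\<rightarrow> \<phi>) \<^bold>\<or>\<^sup>g (\<alpha> \<^bold>\<rightarrow> \<psi>)"
        using sat_ImpI[of t \<alpha> \<phi>] sat_ImpI[of t \<alpha> \<psi>] unfolding sat.simps(5) by blast
    qed
  qed
qed

section \<open>Derivations from hypotheses\<close>

inductive deriv :: "'p form set \<Rightarrow> 'p form \<Rightarrow> bool"  (infix \<open>\<turnstile>\<close> 50) for \<Gamma> where
  hyp: "\<phi> \<in> \<Gamma> \<Longrightarrow> \<Gamma> \<turnstile> \<phi>"
| derivable: "\<turnstile>\<^sub>t\<^sub>I\<^sub>P\<^sub>C \<phi> \<Longrightarrow> \<Gamma> \<turnstile> \<phi>"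
| mp: "\<Gamma> \<turnstile> \<phi> \<^bold>\<rightarrow> \<psi> \<Longrightarrow> \<Gamma> \<turnstile> \<phi> \<Longrightarrow> \<Gamma> \<turnstile> \<psi>"

lemma deriv_empty: "{} \<turnstile> \<phi> \<longleftrightarrow> \<turnstile>\<^sub>t\<^sub>I\<^sub>P\<^sub>C \<phi>"
proof
  show "{} \<turnstile> \<phi> \<Longrightarrow> \<turnstile>\<^sub>t\<^sub>I\<^sub>P\<^sub>C \<phi>"
    by (induction rule: deriv.induct) (auto intro: tIPC.MP)
qed (rule deriv.derivable)

lemma deriv_mono: "\<Gamma> \<turnstile> \<phi> \<Longrightarrow> \<Gamma> \<subseteq> \<Delta> \<Longrightarrow> \<Delta> \<turnstile> \<phi>"
  by (induction rule: deriv.induct) (auto intro: deriv.intros)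

text \<open>Modus Ponens is the only rule, so axioms \<open>K\<close> and \<open>S\<close> suffice,
  for arbitrary formulas.\<close>

lemma deduction_theorem: "insert \<phi> \<Gamma> \<turnstile> \<psi> \<Longrightarrow> \<Gamma> \<turnstile> \<phi> \<^bold>\<rightarrow> \<psi>"
proof (induction rule: deriv.induct)
  case (hyp \<psi>)
  have "\<Gamma> \<turnstile> \<phi> \<^bold>\<rightarrow> \<phi>"
    \<comment> \<open>The combinator term S K K.\<close>
    by (rule deriv.derivable[OF MP[OF K MP[OF K S]]])
  moreover have "\<Gamma> \<turnstile> \<phi> \<^bold>\<rightarrow> \<psi>" if "\<psi> \<in> \<Gamma>"
    by (rule deriv.mp[OF deriv.derivable[OF K] deriv.hyp[OF that]])
  ultimately show ?case using hyp by auto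
next
  case (derivable \<psi>)
  then show ?case by (intro deriv.derivable) (rule MP[OF _ K])
next
  case (mp \<psi> \<chi>)
  then show ?case by (meson S deriv.mp deriv.derivable)
qed

lemma deriv_cut: "insert \<phi> \<Gamma> \<turnstile> \<psi> \<Longrightarrow> \<Gamma> \<turnstile> \<phi> \<Longrightarrow> \<Gamma> \<turnstile> \<psi>"
  using deriv.mp deduction_theorem by blast


section \<open>Natural deduction rules\<close>

lemma andI: "\<Gamma> \<turnstile> \<phi> \<Longrightarrow> \<Gamma> \<turnstile> \<psi> \<Longrightarrow> \<Gamma> \<turnstile> \<phi> \<^bold>\<and> \<psi>"
  by (meson And_intro deriv.derivable deriv.mp)

lemma andE:
  assumes "\<Gamma> \<turnstile> \<phi> \<^bold>\<and> \<psi>"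
  shows "\<Gamma> \<turnstile> \<phi>" "\<Gamma> \<turnstile> \<psi>"
  using assms by (meson And_elim1 And_elim2 deriv.derivable deriv.mp)+

lemma orI1: "\<Gamma> \<turnstile> \<phi> \<Longrightarrow> \<Gamma> \<turnstile> \<phi> \<^bold>\<or> \<psi>"
  by (meson Or_intro deriv.derivable deriv.mp)

lemma or_comm: "\<Gamma> \<turnstile> \<phi> \<^bold>\<or> \<psi> \<Longrightarrow> \<Gamma> \<turnstile> \<psi> \<^bold>\<or> \<phi>"
  by (meson Or_comm deriv.derivable deriv.mp)

lemma orI2: "\<Gamma> \<turnstile> \<psi> \<Longrightarrow> \<Gamma> \<turnstile> \<phi> \<^bold>\<or> \<psi>"
  by (rule or_comm) (rule orI1)

lemma or_elim_standard:
  assumes "standard \<alpha>" "\<Gamma> \<turnstile> \<phi> \<^bold>\<or> \<psi>" "insert \<phi> \<Gamma> \<turnstile> \<alpha>" "insert \<psi> \<Gamma> \<turnstile> \<alpha>"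
  shows "\<Gamma> \<turnstile> \<alpha>"
  using assms by (meson Or_elim deriv.derivable deriv.mp deduction_theorem)

text \<open>Replaces elimination when the conclusion is nonstandard: the disjuncts may be rewritten
  where they stand, but the two cases cannot be merged into one conclusion.\<close>

lemma or_mono:
  assumes "\<Gamma> \<turnstile> \<phi> \<^bold>\<or> \<psi>" "insert \<phi> \<Gamma> \<turnstile> \<phi>'" "insert \<psi> \<Gamma> \<turnstile> \<psi>'"
  shows "\<Gamma> \<turnstile> \<phi>' \<^bold>\<or> \<psi>'"
proof -
  have "\<Gamma> \<turnstile> \<phi>' \<^bold>\<or> \<psi>" using assms(1,2) by (meson Or_mono deriv.derivable deriv.mp deduction_theorem)
  then have "\<Gamma> \<turnstile> \<psi>' \<^bold>\<or> \<phi>'" using assms(3) by (meson Or_mono deriv.derivable deriv.mp deduction_theorem or_comm)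
  then show ?thesis by (rule or_comm)
qed

lemma gorI1: "\<Gamma> \<turnstile> \<phi> \<Longrightarrow> \<Gamma> \<turnstile> \<phi> \<^bold>\<or>\<^sup>g \<psi>"
  by (meson GOr_intro1 deriv.derivable deriv.mp)

lemma gorI2: "\<Gamma> \<turnstile> \<psi> \<Longrightarrow> \<Gamma> \<turnstile> \<phi> \<^bold>\<or>\<^sup>g \<psi>"
  by (meson GOr_intro2 deriv.derivable deriv.mp)

lemma gor_elim:
  assumes "\<Gamma> \<turnstile> \<phi> \<^bold>\<or>\<^sup>g \<psi>" "insert \<phi> \<Gamma> \<turnstile> \<chi>" "insert \<psi> \<Gamma> \<turnstile> \<chi>"
  shows "\<Gamma> \<turnstile> \<chi>"
  using assms by (meson GOr_elim deriv.derivable deriv.mp deduction_theorem)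

section \<open>Global disjunctive normal form\<close>

definition interderivable :: "'p form \<Rightarrow> 'p form \<Rightarrow> bool"  (infix \<open>\<stileturn>\<turnstile>\<close> 50) where
  "\<phi> \<stileturn>\<turnstile> \<psi> \<longleftrightarrow> {\<phi>} \<turnstile> \<psi> \<and> {\<psi>} \<turnstile> \<phi>"

lemma interderivableI: "{\<phi>} \<turnstile> \<psi> \<Longrightarrow> {\<psi>} \<turnstile> \<phi> \<Longrightarrow> \<phi> \<stileturn>\<turnstile> \<psi>"
  by (simp add: interderivable_def)

lemma interderivableD:
  assumes "\<phi> \<stileturn>\<turnstile> \<psi>"
  shows "\<Gamma> \<turnstile> \<phi> \<Longrightarrow> \<Gamma> \<turnstile> \<psi>" "\<Gamma> \<turnstile> \<psi> \<Longrightarrow> \<Gamma> \<turnstile> \<phi>"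
  using assms deriv_cut deriv_mono[of "{\<phi>}" \<psi> "insert \<phi> \<Gamma>"] deriv_mono[of "{\<psi>}" \<phi> "insert \<psi> \<Gamma>"]
  by (auto simp: interderivable_def)

lemma interderivable_refl: "\<phi> \<stileturn>\<turnstile> \<phi>"
  by (simp add: interderivable_def deriv.hyp)

lemma interderivable_trans: "\<phi> \<stileturn>\<turnstile> \<psi> \<Longrightarrow> \<psi> \<stileturn>\<turnstile> \<chi> \<Longrightarrow> \<phi> \<stileturn>\<turnstile> \<chi>"
  by (auto simp: interderivable_def intro: interderivableD)

lemma interderivable_cong:
  assumes "\<phi> \<stileturn>\<turnstile> \<phi>'" "\<psi> \<stileturn>\<turnstile> \<psi>'"
  shows "\<phi> \<^bold>\<and> \<psi> \<stileturn>\<turnstile> \<phi>' \<^bold>\<and> \<psi>'" "\<phi> \<^bold>\<or> \<psi> \<stileturn>\<turnstile> \<phi>' \<^bold>\<or> \<psi>'"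
    "\<phi> \<^bold>\<or>\<^sup>g \<psi> \<stileturn>\<turnstile> \<phi>' \<^bold>\<or>\<^sup>g \<psi>'" "\<phi> \<^bold>\<rightarrow> \<psi> \<stileturn>\<turnstile> \<phi>' \<^bold>\<rightarrow> \<psi>'"
proof -
  \<comment> \<open>One direction is proved for fresh formulas, because the hypotheses are symmetric
    and the converse is the same claim with the pairs exchanged.\<close>
  have "{\<phi> \<^bold>\<and> \<psi>} \<turnstile> \<phi>' \<^bold>\<and> \<psi>' \<and> {\<phi> \<^bold>\<or> \<psi>} \<turnstile> \<phi>' \<^bold>\<or> \<psi>' \<and>
        {\<phi> \<^bold>\<or>\<^sup>g \<psi>} \<turnstile> \<phi>' \<^bold>\<or>\<^sup>g \<psi>' \<and> {\<phi> \<^bold>\<rightarrow> \<psi>} \<turnstile> \<phi>' \<^bold>\<rightarrow> \<psi>'"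
    if "\<phi> \<stileturn>\<turnstile> \<phi>'" "\<psi> \<stileturn>\<turnstile> \<psi>'" for \<phi> \<phi>' \<psi> \<psi>' :: "'a form"
  proof (intro conjI)
    note D = that[THEN interderivableD(1)] that[THEN interderivableD(2)]
    show "{\<phi> \<^bold>\<and> \<psi>} \<turnstile> \<phi>' \<^bold>\<and> \<psi>'"
      using andE[of "{\<phi> \<^bold>\<and> \<psi>}" \<phi> \<psi>] D(1,2) by (simp add: andI deriv.hyp)
    show "{\<phi> \<^bold>\<or> \<psi>} \<turnstile> \<phi>' \<^bold>\<or> \<psi>'"
      by (rule or_mono[of _ \<phi> \<psi>]) (simp_all add: D(1,2) deriv.hyp)
    show "{\<phi> \<^bold>\<or>\<^sup>g \<psi>} \<turnstile> \<phi>' \<^bold>\<or>\<^sup>g \<psi>'"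
      by (rule gor_elim[of _ \<phi> \<psi>]) (simp_all add: D(1,2) gorI1 gorI2 deriv.hyp)
    have "insert \<phi>' {\<phi> \<^bold>\<rightarrow> \<psi>} \<turnstile> \<phi>"
      by (rule D(3)) (simp add: deriv.hyp)
    then have "insert \<phi>' {\<phi> \<^bold>\<rightarrow> \<psi>} \<turnstile> \<psi>"
      by (rule deriv.mp[rotated]) (simp add: deriv.hyp)
    then show "{\<phi> \<^bold>\<rightarrow> \<psi>} \<turnstile> \<phi>' \<^bold>\<rightarrow> \<psi>'"
      by (intro deduction_theorem D(2))
  qed
  from this[OF assms] this[of \<phi>' \<phi> \<psi>' \<psi>] show
    "\<phi> \<^bold>\<and> \<psi> \<stileturn>\<turnstile> \<phi>' \<^bold>\<and> \<psi>'" "\<phi> \<^bold>\<or> \<psi> \<stileturn>\<turnstile> \<phi>' \<^bold>\<or> \<psi>'"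
    "\<phi> \<^bold>\<or>\<^sup>g \<psi> \<stileturn>\<turnstile> \<phi>' \<^bold>\<or>\<^sup>g \<psi>'" "\<phi> \<^bold>\<rightarrow> \<psi> \<stileturn>\<turnstile> \<phi>' \<^bold>\<rightarrow> \<psi>'"
    using assms by (simp_all add: interderivable_def)
qed

section \<open>Commutativity and distribution laws\<close>

lemma and_comm_interderivable: "\<phi> \<^bold>\<and> \<psi> \<stileturn>\<turnstile> \<psi> \<^bold>\<and> \<phi>"
  unfolding interderivable_def by (meson andE andI deriv.hyp insertI1)

lemma or_comm_interderivable: "\<phi> \<^bold>\<or> \<psi> \<stileturn>\<turnstile> \<psi> \<^bold>\<or> \<phi>"
  unfolding interderivable_def by (simp add: deriv.hyp or_comm)

lemma and_gor_distrib: "\<phi> \<^bold>\<and> (\<psi> \<^bold>\<or>\<^sup>g \<chi>) \<stileturn>\<turnstile> (\<phi> \<^bold>\<and> \<psi>) \<^bold>\<or>\<^sup>g (\<phi> \<^bold>\<and> \<chi>)"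
proof (rule interderivableI)
  let ?G = "{\<phi> \<^bold>\<and> (\<psi> \<^bold>\<or>\<^sup>g \<chi>)}"
  have *: "insert \<theta> ?G \<turnstile> \<phi>" "?G \<turnstile> \<psi> \<^bold>\<or>\<^sup>g \<chi>" for \<theta>
    by (rule andE[of _ \<phi> "\<psi> \<^bold>\<or>\<^sup>g \<chi>"], simp add: deriv.hyp)+
  show "?G \<turnstile> (\<phi> \<^bold>\<and> \<psi>) \<^bold>\<or>\<^sup>g (\<phi> \<^bold>\<and> \<chi>)"
    by (rule gor_elim[OF *(2)]) (simp_all add: * gorI1 gorI2 andI deriv.hyp)
  let ?H = "{(\<phi> \<^bold>\<and> \<psi>) \<^bold>\<or>\<^sup>g (\<phi> \<^bold>\<and> \<chi>)}"
  have H: "insert (\<phi> \<^bold>\<and> \<theta>) ?H \<turnstile> \<phi>" "insert (\<phi> \<^bold>\<and> \<theta>) ?H \<turnstile> \<theta>" for \<theta>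
    by (rule andE[of _ \<phi> \<theta>], simp add: deriv.hyp)+
  show "?H \<turnstile> \<phi> \<^bold>\<and> (\<psi> \<^bold>\<or>\<^sup>g \<chi>)"
    by (rule gor_elim[of ?H "\<phi> \<^bold>\<and> \<psi>" "\<phi> \<^bold>\<and> \<chi>"])
      (simp_all add: H andI gorI1 gorI2 deriv.hyp)
qed

text \<open>Left to right is axiom 6. The converse has a nonstandard conclusion, so each global
  disjunct is handled by rewriting under the local disjunction.\<close>

lemma or_gor_distrib: "\<phi> \<^bold>\<or> (\<psi> \<^bold>\<or>\<^sup>g \<chi>) \<stileturn>\<turnstile> (\<phi> \<^bold>\<or> \<psi>) \<^bold>\<or>\<^sup>g (\<phi> \<^bold>\<or> \<chi>)"
proof (rule interderivableI)
  show "{\<phi> \<^bold>\<or> (\<psi> \<^bold>\<or>\<^sup>g \<chi>)} \<turnstile> (\<phi> \<^bold>\<or> \<psi>) \<^bold>\<or>\<^sup>g (\<phi> \<^bold>\<or> \<chi>)"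
    by (rule deriv.mp[OF deriv.derivable[OF Or_GOr_distrib]]) (simp add: deriv.hyp)
  let ?H = "{(\<phi> \<^bold>\<or> \<psi>) \<^bold>\<or>\<^sup>g (\<phi> \<^bold>\<or> \<chi>)}"
  have H1: "insert (\<phi> \<^bold>\<or> \<psi>) ?H \<turnstile> \<phi> \<^bold>\<or> (\<psi> \<^bold>\<or>\<^sup>g \<chi>)"
    by (rule or_mono[of _ \<phi> \<psi>]) (simp_all add: gorI1 deriv.hyp)
  have H2: "insert (\<phi> \<^bold>\<or> \<chi>) ?H \<turnstile> \<phi> \<^bold>\<or> (\<psi> \<^bold>\<or>\<^sup>g \<chi>)"
    by (rule or_mono[of _ \<phi> \<chi>]) (simp_all add: gorI2 deriv.hyp)
  show "?H \<turnstile> \<phi> \<^bold>\<or> (\<psi> \<^bold>\<or>\<^sup>g \<chi>)"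
    by (rule gor_elim[of ?H "\<phi> \<^bold>\<or> \<psi>" "\<phi> \<^bold>\<or> \<chi>"]) (simp_all add: H1 H2 deriv.hyp)
qed

text \<open>Left to right is axiom 8. Its restriction is the reason why an antecedent has to be
  normalized before the implication is distributed.\<close>

lemma standard_imp_gor_distrib:
  assumes "standard \<alpha>"
  shows "\<alpha> \<^bold>\<rightarrow> (\<psi> \<^bold>\<or>\<^sup>g \<chi>) \<stileturn>\<turnstile> (\<alpha> \<^bold>\<rightarrow> \<psi>) \<^bold>\<or>\<^sup>g (\<alpha> \<^bold>\<rightarrow> \<chi>)"
proof (rule interderivableI)
  show "{\<alpha> \<^bold>\<rightarrow> (\<psi> \<^bold>\<or>\<^sup>g \<chi>)} \<turnstile> (\<alpha> \<^bold>\<rightarrow> \<psi>) \<^bold>\<or>\<^sup>g (\<alpha> \<^bold>\<rightarrow> \<chi>)"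
    by (rule deriv.mp[OF deriv.derivable[OF Split[OF assms]]]) (simp add: deriv.hyp)
  let ?H = "{(\<alpha> \<^bold>\<rightarrow> \<psi>) \<^bold>\<or>\<^sup>g (\<alpha> \<^bold>\<rightarrow> \<chi>)}"
  have H: "insert \<alpha> (insert (\<alpha> \<^bold>\<rightarrow> \<theta>) ?H) \<turnstile> \<theta>" for \<theta>
    by (rule deriv.mp[of _ \<alpha>]) (simp_all add: deriv.hyp)
  show "?H \<turnstile> \<alpha> \<^bold>\<rightarrow> (\<psi> \<^bold>\<or>\<^sup>g \<chi>)"
    by (rule gor_elim[of ?H "\<alpha> \<^bold>\<rightarrow> \<psi>" "\<alpha> \<^bold>\<rightarrow> \<chi>"])
      (simp_all add: H deduction_theorem gorI1 gorI2 deriv.hyp)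
qed

text \<open>Breaks up a nonstandard antecedent until only implications with standard antecedents
  remain.\<close>

lemma gor_imp_distrib: "(\<phi> \<^bold>\<or>\<^sup>g \<psi>) \<^bold>\<rightarrow> \<chi> \<stileturn>\<turnstile> (\<phi> \<^bold>\<rightarrow> \<chi>) \<^bold>\<and> (\<psi> \<^bold>\<rightarrow> \<chi>)"
proof (rule interderivableI)
  let ?G = "{(\<phi> \<^bold>\<or>\<^sup>g \<psi>) \<^bold>\<rightarrow> \<chi>}"
  have "insert \<phi> ?G \<turnstile> \<chi>" "insert \<psi> ?G \<turnstile> \<chi>"
    by (rule deriv.mp[of _ "\<phi> \<^bold>\<or>\<^sup>g \<psi>"], simp_all add: gorI1 gorI2 deriv.hyp)+
  then show "?G \<turnstile> (\<phi> \<^bold>\<rightarrow> \<chi>) \<^bold>\<and> (\<psi> \<^bold>\<rightarrow> \<chi>)"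
    by (simp add: andI deduction_theorem)
  let ?H = "{(\<phi> \<^bold>\<rightarrow> \<chi>) \<^bold>\<and> (\<psi> \<^bold>\<rightarrow> \<chi>)}"
  have "?H \<turnstile> \<phi> \<^bold>\<rightarrow> \<chi>" "?H \<turnstile> \<psi> \<^bold>\<rightarrow> \<chi>"
    by (rule andE[of _ "\<phi> \<^bold>\<rightarrow> \<chi>" "\<psi> \<^bold>\<rightarrow> \<chi>"], simp add: deriv.hyp)+
  then show "?H \<turnstile> (\<phi> \<^bold>\<or>\<^sup>g \<psi>) \<^bold>\<rightarrow> \<chi>"
    by (meson GOr_elim deriv.derivable deriv.mp)
qed

text \<open>Normal forms are binary trees of global disjunctions with standard leaves. The parameter
  \<open>P\<close> keeps the leaves within the variables that U(n) interprets.\<close>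

inductive gdnf :: "'p set \<Rightarrow> 'p form \<Rightarrow> bool" for P where
  standard: "standard \<alpha> \<Longrightarrow> props \<alpha> \<subseteq> P \<Longrightarrow> gdnf P \<alpha>"
| gor: "gdnf P \<phi> \<Longrightarrow> gdnf P \<psi> \<Longrightarrow> gdnf P (\<phi> \<^bold>\<or>\<^sup>g \<psi>)"

definition has_gdnf :: "'p set \<Rightarrow> 'p form \<Rightarrow> bool" where
  "has_gdnf P \<phi> \<longleftrightarrow> (\<exists>\<psi>. gdnf P \<psi> \<and> \<phi> \<stileturn>\<turnstile> \<psi>)"

lemma has_gdnf_standard: "standard \<alpha> \<Longrightarrow> props \<alpha> \<subseteq> P \<Longrightarrow> has_gdnf P \<alpha>"
  unfolding has_gdnf_def using gdnf.standard interderivable_refl by blast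

lemma has_gdnf_interderivable: "\<phi> \<stileturn>\<turnstile> \<psi> \<Longrightarrow> has_gdnf P \<psi> \<Longrightarrow> has_gdnf P \<phi>"
  unfolding has_gdnf_def using interderivable_trans by blast

lemma has_gdnf_gor: "has_gdnf P \<phi> \<Longrightarrow> has_gdnf P \<psi> \<Longrightarrow> has_gdnf P (\<phi> \<^bold>\<or>\<^sup>g \<psi>)"
  unfolding has_gdnf_def using gdnf.gor interderivable_cong(3) by blast

text \<open>Induction on the left conjunct, with an inner one on the right. Distribution acts on the
  right, so a global disjunction on the left is commuted into place, and the induction hypotheses
  are commuted to match.\<close>

lemma gdnf_and: "gdnf P \<phi> \<Longrightarrow> gdnf P \<psi> \<Longrightarrow> has_gdnf P (\<phi> \<^bold>\<and> \<psi>)"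
proof (induction arbitrary: \<psi> rule: gdnf.induct)
  case (standard \<alpha>)
  from standard.prems show ?case
  proof (induction rule: gdnf.induct)
    case (standard \<beta>)
    then show ?case using \<open>standard \<alpha>\<close> \<open>props \<alpha> \<subseteq> P\<close> by (intro has_gdnf_standard) auto
  next
    case (gor \<psi> \<chi>)
    then show ?case by (intro has_gdnf_interderivable[OF and_gor_distrib] has_gdnf_gor)
  qed
next
  case (gor \<phi> \<phi>')
  have "has_gdnf P (\<psi> \<^bold>\<and> \<phi>)" "has_gdnf P (\<psi> \<^bold>\<and> \<phi>')"
    by (rule has_gdnf_interderivable[OF and_comm_interderivable], rule gor.IH, rule gor.prems)+
  then show ?case
    by (rule has_gdnf_interderivable[OF and_comm_interderivable
          has_gdnf_interderivable[OF and_gor_distrib has_gdnf_gor]])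
qed

lemma gdnf_or: "gdnf P \<phi> \<Longrightarrow> gdnf P \<psi> \<Longrightarrow> has_gdnf P (\<phi> \<^bold>\<or> \<psi>)"
proof (induction arbitrary: \<psi> rule: gdnf.induct)
  case (standard \<alpha>)
  from standard.prems show ?case
  proof (induction rule: gdnf.induct)
    case (standard \<beta>)
    then show ?case using \<open>standard \<alpha>\<close> \<open>props \<alpha> \<subseteq> P\<close> by (intro has_gdnf_standard) auto
  next
    case (gor \<psi> \<chi>)
    then show ?case by (intro has_gdnf_interderivable[OF or_gor_distrib] has_gdnf_gor)
  qed
next
  case (gor \<phi> \<phi>')
  have "has_gdnf P (\<psi> \<^bold>\<or> \<phi>)" "has_gdnf P (\<psi> \<^bold>\<or> \<phi>')"
    by (rule has_gdnf_interderivable[OF or_comm_interderivable], rule gor.IH, rule gor.prems)+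
  then show ?case
    by (rule has_gdnf_interderivable[OF or_comm_interderivable
          has_gdnf_interderivable[OF or_gor_distrib has_gdnf_gor]])
qed

lemma has_gdnf_and: "has_gdnf P \<phi> \<Longrightarrow> has_gdnf P \<psi> \<Longrightarrow> has_gdnf P (\<phi> \<^bold>\<and> \<psi>)"
  unfolding has_gdnf_def[of P \<phi>] has_gdnf_def[of P \<psi>]
  by (elim exE conjE) (rule has_gdnf_interderivable[OF interderivable_cong(1) gdnf_and])

text \<open>A disjunctive antecedent leaves a conjunction of implications that are merely equivalent
  to normal forms; \<open>has_gdnf_and\<close> is what normalizes it.\<close>

lemma gdnf_imp: "gdnf P \<phi> \<Longrightarrow> gdnf P \<psi> \<Longrightarrow> has_gdnf P (\<phi> \<^bold>\<rightarrow> \<psi>)"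
proof (induction arbitrary: \<psi> rule: gdnf.induct)
  case (standard \<alpha>)
  from standard.prems show ?case
  proof (induction rule: gdnf.induct)
    case (standard \<beta>)
    then show ?case using \<open>standard \<alpha>\<close> \<open>props \<alpha> \<subseteq> P\<close> by (intro has_gdnf_standard) auto
  next
    case (gor \<psi> \<chi>)
    then show ?case
      by (intro has_gdnf_interderivable[OF standard_imp_gor_distrib[OF \<open>standard \<alpha>\<close>]]
          has_gdnf_gor)
  qed
next
  case (gor \<phi> \<phi>')
  then show ?case by (intro has_gdnf_interderivable[OF gor_imp_distrib] has_gdnf_and)
qed

lemma has_gdnf_or: "has_gdnf P \<phi> \<Longrightarrow> has_gdnf P \<psi> \<Longrightarrow> has_gdnf P (\<phi> \<^bold>\<or> \<psi>)"
  unfolding has_gdnf_def[of P \<phi>] has_gdnf_def[of P \<psi>]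
  by (elim exE conjE) (rule has_gdnf_interderivable[OF interderivable_cong(2) gdnf_or])

lemma has_gdnf_imp: "has_gdnf P \<phi> \<Longrightarrow> has_gdnf P \<psi> \<Longrightarrow> has_gdnf P (\<phi> \<^bold>\<rightarrow> \<psi>)"
  unfolding has_gdnf_def[of P \<phi>] has_gdnf_def[of P \<psi>]
  by (elim exE conjE) (rule has_gdnf_interderivable[OF interderivable_cong(4) gdnf_imp])

lemma has_gdnf: "props \<phi> \<subseteq> P \<Longrightarrow> has_gdnf P \<phi>"
  by (induction \<phi>)
    (simp_all add: has_gdnf_standard has_gdnf_and has_gdnf_or has_gdnf_gor has_gdnf_imp)

text \<open>Each global disjunction selects one branch for the whole team. Following the choices
  leads to a leaf, from which the introduction rules recover the tree.\<close>

lemma gdnf_sat_disjunct: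
  "gdnf P \<phi> \<Longrightarrow> M, t \<Turnstile> \<phi> \<Longrightarrow>
     \<exists>\<alpha>. standard \<alpha> \<and> props \<alpha> \<subseteq> P \<and> (M, t \<Turnstile> \<alpha>) \<and> {\<alpha>} \<turnstile> \<phi>"
proof (induction rule: gdnf.induct)
  case (standard \<alpha>)
  then show ?case by (meson deriv.hyp insertI1)
next
  case (gor \<phi> \<psi>)
  then show ?case by (auto intro: gorI1 gorI2)
qed

section \<open>The finite canonical model\<close>

primrec subforms :: "'p form \<Rightarrow> 'p form set" where
  "subforms (Var q) = {Var q}"
| "subforms \<^bold>\<bottom> = {\<^bold>\<bottom>}"
| "subforms (\<phi> \<^bold>\<and> \<psi>) = insert (\<phi> \<^bold>\<and> \<psi>) (subforms \<phi> \<union> subforms \<psi>)"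
| "subforms (\<phi> \<^bold>\<or> \<psi>) = insert (\<phi> \<^bold>\<or> \<psi>) (subforms \<phi> \<union> subforms \<psi>)"
| "subforms (\<phi> \<^bold>\<or>\<^sup>g \<psi>) = insert (\<phi> \<^bold>\<or>\<^sup>g \<psi>) (subforms \<phi> \<union> subforms \<psi>)"
| "subforms (\<phi> \<^bold>\<rightarrow> \<psi>) = insert (\<phi> \<^bold>\<rightarrow> \<psi>) (subforms \<phi> \<union> subforms \<psi>)"

lemma finite_subforms: "finite (subforms \<phi>)"
  by (induction \<phi>) auto

lemma subforms_refl: "\<phi> \<in> subforms \<phi>"
  by (cases \<phi>) auto

lemma subforms_trans: "\<psi> \<in> subforms \<phi> \<Longrightarrow> subforms \<psi> \<subseteq> subforms \<phi>"
  by (induction \<phi>) auto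

lemma standard_subforms: "standard \<phi> \<Longrightarrow> \<psi> \<in> subforms \<phi> \<Longrightarrow> standard \<psi>"
  by (induction \<phi>) auto

text \<open>Closure under derivability is relative to \<open>\<Sigma>\<close>, so a finite
  \<open>\<Sigma>\<close> admits only finitely many theories.\<close>

definition prime_theory :: "'p form set \<Rightarrow> 'p form set \<Rightarrow> bool" where
  "prime_theory \<Sigma> \<Gamma> \<longleftrightarrow> \<Gamma> \<subseteq> \<Sigma> \<and> (\<forall>\<psi>\<in>\<Sigma>. \<Gamma> \<turnstile> \<psi> \<longrightarrow> \<psi> \<in> \<Gamma>) \<and> \<not> \<Gamma> \<turnstile> \<^bold>\<bottom> \<and>
     (\<forall>\<psi> \<chi>. \<psi> \<^bold>\<or> \<chi> \<in> \<Gamma> \<longrightarrow> \<psi> \<in> \<Gamma> \<or> \<chi> \<in> \<Gamma>)"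

text \<open>Take a maximal subset of \<open>\<Sigma>\<close> that does not derive
  \<open>\<chi>\<close>. If it contained a disjunction but neither disjunct, adding either one would
  yield \<open>\<chi>\<close>, and elimination into the standard formula \<open>\<chi>\<close> would
  derive it already.\<close>

lemma prime_theory_extension:
  assumes "finite \<Sigma>" "\<Gamma>\<^sub>0 \<subseteq> \<Sigma>" "standard \<chi>" "\<not> \<Gamma>\<^sub>0 \<turnstile> \<chi>"
    and sub: "\<And>\<psi> \<theta>. \<psi> \<^bold>\<or> \<theta> \<in> \<Sigma> \<Longrightarrow> \<psi> \<in> \<Sigma> \<and> \<theta> \<in> \<Sigma>"
  obtains \<Gamma> where "prime_theory \<Sigma> \<Gamma>" "\<Gamma>\<^sub>0 \<subseteq> \<Gamma>" "\<not> \<Gamma> \<turnstile> \<chi>"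
proof -
  let ?A = "{\<Gamma>. \<Gamma> \<subseteq> \<Sigma> \<and> \<not> \<Gamma> \<turnstile> \<chi>}"
  have "finite ?A" using assms(1) by (auto intro: finite_subset[of _ "Pow \<Sigma>"])
  then obtain \<Gamma> where \<Gamma>: "\<Gamma> \<in> ?A" "\<Gamma>\<^sub>0 \<subseteq> \<Gamma>" and max: "\<And>\<Delta>. \<Delta> \<in> ?A \<Longrightarrow> \<Gamma> \<subseteq> \<Delta> \<Longrightarrow> \<Gamma> = \<Delta>"
    using finite_has_maximal2[of ?A \<Gamma>\<^sub>0] assms(2,4) by auto
  have ext: "insert \<psi> \<Gamma> \<turnstile> \<chi>" if "\<psi> \<in> \<Sigma>" "\<psi> \<notin> \<Gamma>" for \<psi>
    using max[of "insert \<psi> \<Gamma>"] \<Gamma>(1) that by auto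
  have "\<psi> \<in> \<Gamma>" if "\<psi> \<in> \<Sigma>" "\<Gamma> \<turnstile> \<psi>" for \<psi>
    using ext[OF that(1)] deriv_cut that(2) \<Gamma>(1) by blast
  moreover have "\<not> \<Gamma> \<turnstile> \<^bold>\<bottom>"
    using \<Gamma>(1) deriv.mp[OF deriv.derivable[OF Ex_falso]] by blast
  moreover have "\<psi> \<in> \<Gamma> \<or> \<theta> \<in> \<Gamma>" if "\<psi> \<^bold>\<or> \<theta> \<in> \<Gamma>" for \<psi> \<theta>
    using or_elim_standard[OF assms(3), of \<Gamma> \<psi> \<theta>] ext sub[of \<psi> \<theta>] \<Gamma>(1) that deriv.hyp[OF that]
    by blast
  ultimately have "prime_theory \<Sigma> \<Gamma>" using \<Gamma>(1) by (auto simp: prime_theory_def)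
  then show thesis using \<Gamma> that by blast
qed

definition canonical_model :: "'p form set \<Rightarrow> ('p form set, 'p) model" where
  "canonical_model \<Sigma> = \<lparr>
     worlds = {\<Gamma>. prime_theory \<Sigma> \<Gamma>},
     acc = {(\<Gamma>, \<Delta>). prime_theory \<Sigma> \<Gamma> \<and> prime_theory \<Sigma> \<Delta> \<and> \<Gamma> \<subseteq> \<Delta>},
     val = (\<lambda>q. {\<Gamma>. prime_theory \<Sigma> \<Gamma> \<and> Var q \<in> \<Gamma>})\<rparr>"

text \<open>The truth lemma. An implication outside \<open>\<Gamma>\<close> is refuted by extending
  \<open>insert \<phi> \<Gamma>\<close> to a prime theory avoiding \<open>\<psi>\<close>, which is
  standard as a subformula of \<open>\<alpha>\<close>.\<close>

lemma canonical_model_truth: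
  assumes "standard \<alpha>"
  shows "prime_theory (subforms \<alpha>) \<Gamma> \<Longrightarrow> \<psi> \<in> subforms \<alpha> \<Longrightarrow>
    forces (canonical_model (subforms \<alpha>)) \<Gamma> \<psi> \<longleftrightarrow> \<psi> \<in> \<Gamma>"
proof (induction \<psi> arbitrary: \<Gamma>)
  case (Var q)
  then show ?case by (simp add: canonical_model_def)
next
  case Bot
  then show ?case using deriv.hyp by (auto simp: prime_theory_def)
next
  case (And \<phi> \<psi>)
  have sub: "\<phi> \<in> subforms \<alpha>" "\<psi> \<in> subforms \<alpha>"
    using subforms_trans[OF And.prems(2)] subforms_refl by auto
  have "\<phi> \<^bold>\<and> \<psi> \<in> \<Gamma> \<longleftrightarrow> \<phi> \<in> \<Gamma> \<and> \<psi> \<in> \<Gamma>"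
    using And.prems sub unfolding prime_theory_def by (meson andE andI deriv.hyp)
  then show ?case using And sub by simp
next
  case (Or \<phi> \<psi>)
  have sub: "\<phi> \<in> subforms \<alpha>" "\<psi> \<in> subforms \<alpha>"
    using subforms_trans[OF Or.prems(2)] subforms_refl by auto
  have "\<phi> \<^bold>\<or> \<psi> \<in> \<Gamma> \<longleftrightarrow> \<phi> \<in> \<Gamma> \<or> \<psi> \<in> \<Gamma>"
    using Or.prems sub unfolding prime_theory_def by (meson orI1 orI2 deriv.hyp)
  then show ?case using Or sub by simp
next
  case (GOr \<phi> \<psi>)
  \<comment> \<open>Vacuous: no subformula of a standard formula is a global disjunction.\<close>
  then show ?case using standard_subforms[OF assms] by force
next
  case (Imp \<phi> \<psi>)
  let ?S = "subforms \<alpha>"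
  have sub: "\<phi> \<in> ?S" "\<psi> \<in> ?S"
    using subforms_trans[OF Imp.prems(2)] subforms_refl by auto
  have "forces (canonical_model ?S) \<Gamma> (\<phi> \<^bold>\<rightarrow> \<psi>) \<longleftrightarrow>
      (\<forall>\<Delta>. prime_theory ?S \<Delta> \<longrightarrow> \<Gamma> \<subseteq> \<Delta> \<longrightarrow> \<phi> \<in> \<Delta> \<longrightarrow> \<psi> \<in> \<Delta>)"
    using Imp sub by (auto simp: canonical_model_def)
  also have "\<dots> \<longleftrightarrow> \<phi> \<^bold>\<rightarrow> \<psi> \<in> \<Gamma>"
  proof
    assume all: "\<forall>\<Delta>. prime_theory ?S \<Delta> \<longrightarrow> \<Gamma> \<subseteq> \<Delta> \<longrightarrow> \<phi> \<in> \<Delta> \<longrightarrow> \<psi> \<in> \<Delta>"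
    have "insert \<phi> \<Gamma> \<turnstile> \<psi>"
    proof (rule ccontr)
      assume "\<not> insert \<phi> \<Gamma> \<turnstile> \<psi>"
      moreover have "insert \<phi> \<Gamma> \<subseteq> ?S" using sub(1) Imp.prems(1) by (simp add: prime_theory_def)
      moreover have "\<beta> \<in> ?S \<and> \<theta> \<in> ?S" if "\<beta> \<^bold>\<or> \<theta> \<in> ?S" for \<beta> \<theta>
        using subforms_trans[OF that] subforms_refl by auto
      ultimately obtain \<Delta> where "prime_theory ?S \<Delta>" "insert \<phi> \<Gamma> \<subseteq> \<Delta>" "\<not> \<Delta> \<turnstile> \<psi>"
        using prime_theory_extension[OF finite_subforms, of "insert \<phi> \<Gamma>" \<alpha> \<psi>]
          standard_subforms[OF assms sub(2)] by blast
      then show False using all deriv.hyp by blast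
    qed
    then have "\<Gamma> \<turnstile> \<phi> \<^bold>\<rightarrow> \<psi>" by (rule deduction_theorem)
    then show "\<phi> \<^bold>\<rightarrow> \<psi> \<in> \<Gamma>" using Imp.prems by (simp add: prime_theory_def)
  next
    assume "\<phi> \<^bold>\<rightarrow> \<psi> \<in> \<Gamma>"
    then show "\<forall>\<Delta>. prime_theory ?S \<Delta> \<longrightarrow> \<Gamma> \<subseteq> \<Delta> \<longrightarrow> \<phi> \<in> \<Delta> \<longrightarrow> \<psi> \<in> \<Delta>"
      using sub(2) unfolding prime_theory_def by (meson deriv.hyp deriv.mp subsetD)
  qed
  finally show ?case .
qed

lemma finite_countermodel:
  assumes "standard \<alpha>" "\<not> \<turnstile>\<^sub>t\<^sub>I\<^sub>P\<^sub>C \<alpha>"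
  obtains M :: "('p form set, 'p) model" and w
  where "kripke_model M" "finite (worlds M)" "w \<in> worlds M" "\<not> forces M w (\<alpha> :: 'p form)"
proof -
  let ?S = "subforms \<alpha>" and ?M = "canonical_model (subforms \<alpha>)"
  have "\<beta> \<in> ?S \<and> \<theta> \<in> ?S" if "\<beta> \<^bold>\<or> \<theta> \<in> ?S" for \<beta> \<theta>
    using subforms_trans[OF that] subforms_refl by auto
  \<comment> \<open>The extension of the empty theory is the refuting point, and it also witnesses
    that the model has a world.\<close>
  then obtain \<Gamma> where \<Gamma>: "prime_theory ?S \<Gamma>" "\<not> \<Gamma> \<turnstile> \<alpha>"
    using prime_theory_extension[OF finite_subforms, of "{}" \<alpha> \<alpha>] assms deriv_empty by blast
  have "finite (worlds ?M)"
    by (rule finite_subset[of _ "Pow ?S"])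
      (auto simp: canonical_model_def prime_theory_def finite_subforms)
  moreover have "kripke_model ?M"
    using \<Gamma>(1) by (auto simp: kripke_model_def canonical_model_def partial_order_on_def
        preorder_on_def refl_on_def trans_def antisym_def)
  moreover have "\<not> forces ?M \<Gamma> \<alpha>"
    using \<Gamma> canonical_model_truth[OF assms(1) \<Gamma>(1) subforms_refl] deriv.hyp by blast
  ultimately show thesis using that[of ?M \<Gamma>] \<Gamma>(1) by (simp add: canonical_model_def)
qed

section \<open>Bounded morphisms into the universal model\<close>

text \<open>The immediate successors of the desired node must be the minimal elements
  \<open>A\<close> of \<open>S\<close>. If \<open>A\<close> is a single node that already has color
  \<open>c\<close>, clause (i) provides no new node, since it demands a strictly smaller color; that
  node is then taken itself. This is why the cone is described as \<open>insert x S\<close>, with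
  \<open>x\<close> possibly in \<open>S\<close>.\<close>

lemma universal_worlds_extend:
  assumes "finite S" "S \<subseteq> universal_worlds n" "length c = n"
    and closed: "\<And>x y. x \<in> S \<Longrightarrow> (x, y) \<in> succ_rel\<^sup>* \<Longrightarrow> y \<in> S"
    and le: "\<And>x. x \<in> S \<Longrightarrow> color_le c (label x)"
  obtains x where "x \<in> universal_worlds n" "label x = c" "{y. (x, y) \<in> succ_rel\<^sup>*} = insert x S"
proof -
  define A where "A = {x \<in> S. \<forall>y\<in>S. (y, x) \<in> succ_rel\<^sup>* \<longrightarrow> y = x}"
  have fin: "finite A" using assms(1) by (simp add: A_def)
  have incomparable: "(x, y) \<notin> succ_rel\<^sup>*" if "x \<in> A" "y \<in> A" "x \<noteq> y" for x y
    using that by (auto simp: A_def)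
  have minimal: "\<exists>x\<in>A. (x, y) \<in> succ_rel\<^sup>*" if y: "y \<in> S" for y
  proof -
    let ?B = "{x \<in> S. (x, y) \<in> succ_rel\<^sup>*}"
    \<comment> \<open>The strict order on the finite set \<open>S\<close> is well-founded, so every
      element has a minimal one below it.\<close>
    define r where "r = {(v, w). v \<in> S \<and> w \<in> S \<and> v \<noteq> w \<and> (v, w) \<in> succ_rel\<^sup>*}"
    have "finite r" by (rule finite_subset[of _ "S \<times> S"]) (auto simp: r_def assms(1))
    moreover have "trans r" "irrefl r"
      using antisym_succ_rel by (auto simp: r_def trans_def irrefl_def dest: antisymD)
    then have "acyclic r" by (simp add: acyclic_irrefl)
    ultimately have "wf r" by (rule finite_acyclic_wf)
    then obtain x where "x \<in> ?B" "\<And>z. (z, x) \<in> r \<Longrightarrow> z \<notin> ?B"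
      using wfE_min[of r y ?B] y by blast
    then have "x \<in> A" "(x, y) \<in> succ_rel\<^sup>*"
      by (auto simp: A_def r_def intro: rtrancl_trans)
    then show ?thesis by blast
  qed
  have above: "(\<Union>x\<in>A. {y. (x, y) \<in> succ_rel\<^sup>*}) = S"
    using minimal closed by (auto simp: A_def)
  show thesis
  proof (cases "\<exists>u. A = {u} \<and> label u = c")
    case True
    then obtain u where u: "A = {u}" "label u = c" by blast
    then have "u \<in> S" "{y. (u, y) \<in> succ_rel\<^sup>*} = S" using above by (auto simp: A_def)
    then show thesis using that[of u] u assms(2) by auto
  next
    case False
    define x where "x = Node c (Abs_fset A)"
    have succs: "fset (succs x) = A" using fin by (simp add: x_def Abs_fset_inverse)
    have "{y. (x, y) \<in> succ_rel\<^sup>*} = insert x (\<Union>u\<in>A. {y. (u, y) \<in> succ_rel\<^sup>*})"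
    proof -
      have "(x, y) \<in> succ_rel\<^sup>* \<longleftrightarrow> y = x \<or> (\<exists>u\<in>A. (u, y) \<in> succ_rel\<^sup>*)" for y
        using succs by (subst rtrancl_eq_or_trancl)
          (auto simp: succ_rel_def trancl_unfold_left)
      then show ?thesis by auto
    qed
    moreover have "x \<in> universal_worlds n"
    proof -
      have "\<exists>j. layer n j u" if "u \<in> A" for u
        using that assms(2) by (auto simp: A_def universal_worlds_def)
      then obtain j where j: "\<And>u. u \<in> A \<Longrightarrow> layer n (j u) u" by metis
      \<comment> \<open>The cases match the clauses for the first layer, (i) and (ii).\<close>
      consider "A = {}" | u where "A = {u}" | "2 \<le> card A"
      proof -
        have "card A = 0 \<or> card A = 1 \<or> 2 \<le> card A" by linarith
        then show thesis using that fin by (auto simp: card_1_singleton_iff)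
      qed
      then show ?thesis
      proof cases
        case 1
        then have "succs x = {||}" using succs by (simp flip: fset_inject)
        then have "x = Node c {||}" by (simp add: x_def)
        then show ?thesis using layer.first[OF assms(3)] by (auto simp: universal_worlds_def)
      next
        case (2 u)
        then have "succs x = {|u|}" using succs by (simp flip: fset_inject)
        then have "x = Node c {|u|}" by (simp add: x_def)
        moreover have "color_less c (label u)"
          using 2 False le[of u] by (auto simp: color_less_def A_def)
        ultimately show ?thesis
          using layer.single[of n "j u" u c] j[of u] 2 by (auto simp: universal_worlds_def)
      next
        case 3
        \<comment> \<open>Clause (ii) asks for a successor in the layer just below the new node, so
          the largest chosen layer index is taken.\<close>
        let ?k = "Max (j ` A)"
        have "A \<noteq> {}" using 3 by auto
        then obtain u where u: "u \<in> A" "j u = ?k"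
          using Max_in[of "j ` A"] fin by fastforce
        have "layer n (Suc ?k) (Node c (succs x))"
        proof (rule layer.multi)
          show "2 \<le> fcard (succs x)" using 3 succs by (simp add: fcard.rep_eq)
          show "\<forall>w. w |\<in>| succs x \<longrightarrow> (\<exists>i\<le>?k. layer n i w)"
            using j fin by (simp add: succs) (metis Max_ge finite_imageI image_eqI)
          show "\<exists>w. w |\<in>| succs x \<and> layer n ?k w"
            using u j[of u] succs by auto
          show "\<forall>v w. v |\<in>| succs x \<longrightarrow> w |\<in>| succs x \<longrightarrow> v \<noteq> w \<longrightarrow> (v, w) \<notin> succ_rel\<^sup>*"
            using incomparable by (simp add: succs)
          show "\<forall>w. w |\<in>| succs x \<longrightarrow> color_le c (label w)"
            using le by (simp add: succs A_def)
        qed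
        then show ?thesis by (auto simp: universal_worlds_def x_def)
      qed
    qed
    ultimately show thesis using that[of x] above by (simp add: x_def)
  qed
qed

text \<open>Recursion from the top of the finite model downwards: once all proper successors of
  \<open>w\<close> have images, these images form an upward closed set, and
  \<open>universal_worlds_extend\<close> provides the image of \<open>w\<close>.\<close>

lemma ex_bounded_morphism_universal_model:
  fixes M :: "('w, 'p) model"
  assumes M: "kripke_model M" and fin: "finite (worlds M)"
  obtains f where
    "\<And>w. w \<in> worlds M \<Longrightarrow> f w \<in> universal_worlds n"
    "\<And>w. w \<in> worlds M \<Longrightarrow> label (f w) = color n p M w"
    "\<And>w. w \<in> worlds M \<Longrightarrow> {y. (f w, y) \<in> succ_rel\<^sup>*} = f ` {v. (w, v) \<in> acc M}"
proof -
  define R where "R = {(v, w). (w, v) \<in> acc M \<and> v \<noteq> w}"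
  \<comment> \<open>Choice along \<open>R\<close> allows the condition on the candidate
    \<open>x\<close> to consult \<open>f\<close> at proper successors of \<open>w\<close> only, so
    \<open>insert x\<close> stands for the image of \<open>w\<close> itself.\<close>
  let ?P = "\<lambda>f w x. w \<in> worlds M \<longrightarrow> x \<in> universal_worlds n \<and> label x = color n p M w \<and>
      {y. (x, y) \<in> succ_rel\<^sup>*} = insert x (f ` {v. (v, w) \<in> R})"
  note acc = kripke_model_acc[OF M]
  have "finite R"
    by (rule finite_subset[of _ "worlds M \<times> worlds M"]) (use acc(4) fin in \<open>auto simp: R_def\<close>)
  moreover have "trans R" "irrefl R"
    using acc(2,3) by (auto simp: R_def trans_def irrefl_def)
  then have "acyclic R" by (simp add: acyclic_irrefl)
  ultimately have "wf R" by (rule finite_acyclic_wf)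
  have up: "{v. (w, v) \<in> acc M} = insert w {v. (v, w) \<in> R}" if "w \<in> worlds M" for w
    using acc(1)[OF that] by (auto simp: R_def)
  have "\<exists>f. \<forall>w. ?P f w (f w)"
  proof (rule dependent_wf_choice[OF \<open>wf R\<close>])
    fix f g :: "'w \<Rightarrow> node" and w x assume "\<And>v. (v, w) \<in> R \<Longrightarrow> f v = g v"
    then have "f ` {v. (v, w) \<in> R} = g ` {v. (v, w) \<in> R}" by auto
    then show "?P f w x = ?P g w x" by simp
  next
    fix w f assume IH: "\<And>v. (v, w) \<in> R \<Longrightarrow> ?P f v (f v)"
    let ?S = "f ` {v. (v, w) \<in> R}"
    have W: "v \<in> worlds M" if "(v, w) \<in> R" for v using that acc(4) by (auto simp: R_def)
    show "\<exists>x. ?P f w x"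
    proof (cases "w \<in> worlds M")
      case True
      have "finite ?S"
        by (intro finite_imageI finite_subset[OF _ fin]) (use W in auto)
      moreover have "?S \<subseteq> universal_worlds n" using IH W by auto
      moreover have "length (color n p M w) = n" by (simp add: color_def)
      moreover have "y \<in> ?S" if x: "x \<in> ?S" and xy: "(x, y) \<in> succ_rel\<^sup>*" for x y
      proof -
        obtain v where v: "(v, w) \<in> R" "x = f v" using x by auto
        then have "y = f v \<or> (\<exists>u. (u, v) \<in> R \<and> y = f u)" using IH[OF v(1)] W xy by blast
        then show ?thesis using v(1) \<open>trans R\<close> by (auto dest: transD)
      qed
      \<comment> \<open>Persistence of the valuation makes colors grow along the order.\<close>
      moreover have "color_le (color n p M w) (label x)" if x: "x \<in> ?S" for x
      proof -
        obtain v where v: "(v, w) \<in> R" "x = f v" using x by auto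
        then have "label x = color n p M v" using IH W by blast
        then show ?thesis using v acc(5)
          by (auto simp: color_le_def color_def list_all2_conv_all_nth R_def)
      qed
      ultimately show ?thesis using universal_worlds_extend[of ?S n "color n p M w"] by metis
    qed simp
  qed
  then obtain f where f: "\<And>w. ?P f w (f w)" by blast
  show thesis
    by (rule that[of f]) (use f up in auto)
qed

text \<open>The equation between cones holds both morphism conditions: its right-to-left inclusion
  is the forth condition, the other one the back condition. Injectivity of \<open>p\<close> lets a
  variable be read off a single coordinate of the color.\<close>

lemma forces_bounded_morphism:
  assumes inj: "inj_on p {..<n}"
    and f: "\<And>w. w \<in> worlds M \<Longrightarrow> f w \<in> universal_worlds n"
      "\<And>w. w \<in> worlds M \<Longrightarrow> label (f w) = color n p M w"
      "\<And>w. w \<in> worlds M \<Longrightarrow> {y. (f w, y) \<in> succ_rel\<^sup>*} = f ` {v. (w, v) \<in> acc M}"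
    and M: "kripke_model M"
  shows "w \<in> worlds M \<Longrightarrow> props \<phi> \<subseteq> p ` {..<n} \<Longrightarrow>
    forces (universal_model n p) (f w) \<phi> \<longleftrightarrow> forces M w \<phi>"
proof (induction \<phi> arbitrary: w)
  case (Var q)
  then obtain i where i: "i < n" "q = p i" by auto
  then have "(\<exists>j<n. q = p j \<and> label (f w) ! j) \<longleftrightarrow> w \<in> val M q"
    using inj f(2)[OF Var(1)] by (auto simp: color_def inj_on_def)
  then show ?case using f(1)[OF Var(1)] by (simp add: universal_model_def)
next
  case (Imp \<phi> \<psi>)
  have "(f w, y) \<in> acc (universal_model n p) \<longleftrightarrow> y \<in> f ` {v. (w, v) \<in> acc M}" for y
    using f(1,3)[OF Imp.prems(1)] universal_worlds_closed
    by (auto simp: universal_model_def)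
  then have "forces (universal_model n p) (f w) (\<phi> \<^bold>\<rightarrow> \<psi>) \<longleftrightarrow>
      (\<forall>v. (w, v) \<in> acc M \<longrightarrow> forces (universal_model n p) (f v) \<phi> \<longrightarrow>
        forces (universal_model n p) (f v) \<psi>)"
    by auto
  also have "\<dots> \<longleftrightarrow> forces M w (\<phi> \<^bold>\<rightarrow> \<psi>)"
    using Imp kripke_model_acc(4)[OF M] by auto
  finally show ?case .
qed auto

section \<open>Completeness and the equivalence\<close>

lemma universal_model_complete_standard:
  fixes p :: "nat \<Rightarrow> 'p"
  assumes "inj_on p {..<n}" "standard \<alpha>" "props \<alpha> \<subseteq> p ` {..<n}"
    and valid: "\<forall>w\<in>universal_worlds n. forces (universal_model n p) w \<alpha>"
  shows "\<turnstile>\<^sub>t\<^sub>I\<^sub>P\<^sub>C \<alpha>"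
proof (rule ccontr)
  assume "\<not> \<turnstile>\<^sub>t\<^sub>I\<^sub>P\<^sub>C \<alpha>"
  then obtain M :: "('p form set, 'p) model" and w
    where M: "kripke_model M" "finite (worlds M)" "w \<in> worlds M" "\<not> forces M w \<alpha>"
    by (rule finite_countermodel[OF assms(2)])
  obtain f where f: "\<And>w. w \<in> worlds M \<Longrightarrow> f w \<in> universal_worlds n"
    "\<And>w. w \<in> worlds M \<Longrightarrow> label (f w) = color n p M w"
    "\<And>w. w \<in> worlds M \<Longrightarrow> {y. (f w, y) \<in> succ_rel\<^sup>*} = f ` {v. (w, v) \<in> acc M}"
    using ex_bounded_morphism_universal_model[OF M(1,2), of n p] by blast
  show False
    using forces_bounded_morphism[OF assms(1) f M(1,3) assms(3)] f(1)[OF M(3)] M(4) valid by blast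
qed

theorem proposition3p13:
  fixes n :: nat and p :: "nat \<Rightarrow> 'p" and \<phi> :: "'p form"
  assumes "inj_on p {..<n}"
    and "props \<phi> \<subseteq> p ` {..<n}"
  shows "(universal_model n p \<Turnstile>\<^sub>t \<phi>) \<longleftrightarrow> (\<turnstile>\<^sub>t\<^sub>I\<^sub>P\<^sub>C \<phi>)"
proof
  let ?U = "universal_model n p"
  note U = kripke_model_universal_model[of n p]
  show "?U \<Turnstile>\<^sub>t \<phi>" if "\<turnstile>\<^sub>t\<^sub>I\<^sub>P\<^sub>C \<phi>"
    using team_soundness[OF U that] .
  assume valid: "?U \<Turnstile>\<^sub>t \<phi>"
  obtain \<psi> where \<psi>: "gdnf (p ` {..<n}) \<psi>" "\<phi> \<stileturn>\<turnstile> \<psi>"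
    using has_gdnf[OF assms(2)] by (auto simp: has_gdnf_def)
  \<comment> \<open>Completeness uses soundness too: it turns derivability of this implication into
    a transfer of satisfaction to the normal form, at the team of all worlds.\<close>
  have "\<turnstile>\<^sub>t\<^sub>I\<^sub>P\<^sub>C \<phi> \<^bold>\<rightarrow> \<psi>"
    using \<psi>(2) deduction_theorem[of \<phi> "{}"] by (simp add: interderivable_def deriv_empty)
  then have "?U, worlds ?U \<Turnstile> \<phi> \<^bold>\<rightarrow> \<psi>" "?U, worlds ?U \<Turnstile> \<phi>"
    using team_soundness[OF U] valid unfolding team_valid_def by blast+
  then have "?U, worlds ?U \<Turnstile> \<psi>"
    using kripke_model_acc(1)[OF U] unfolding sat_Imp_iff[OF U] by blast
  then obtain \<alpha> where \<alpha>: "standard \<alpha>" "props \<alpha> \<subseteq> p ` {..<n}" "?U, worlds ?U \<Turnstile> \<alpha>" "{\<alpha>} \<turnstile> \<psi>"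
    using gdnf_sat_disjunct[OF \<psi>(1)] by blast
  have "worlds ?U = universal_worlds n" by (simp add: universal_model_def)
  then have "\<turnstile>\<^sub>t\<^sub>I\<^sub>P\<^sub>C \<alpha>"
    using \<alpha>(3) sat_standard_iff_forces[OF U \<alpha>(1) order_refl]
      universal_model_complete_standard[OF assms(1) \<alpha>(1,2)] by simp
  then have "{} \<turnstile> \<psi>" using \<alpha>(4) deriv_cut deriv.derivable by blast
  then show "\<turnstile>\<^sub>t\<^sub>I\<^sub>P\<^sub>C \<phi>" using interderivableD(2)[OF \<psi>(2)] deriv_empty by blast
qed

end
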